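(* Let $X, Y$ be separably metrizable spaces. Then every closed linear map from $(C_b(X),\beta)$ to $(C_b(Y),\beta)$ (that is, every linear map $T: C_b(X)\to C_b(Y)$ whose graph is closed in the product of the two spaces) is continuous, where $\beta$ denotes the strict topology on the respective space.
   Context: For a separably metrizable space $Z$, $C_b(Z)$ is the space of bounded continuous real-valued functions on $Z$. Strict topology $\beta$ on $C_b(Z)$: let $\check{Z}$ be the Stone-Čech compactification of $Z$. For each compact $Q \subseteq \check{Z}\setminus Z$ (including $Q=\emptyset$) let $\beta_Q$ be the locally convex topology on $C_b(Z)$ generated by the seminorms $f \mapsto \sup_{z\in Z}|h(z)f(z)|$, where $h$ ranges over the continuous functions on $\check{Z}$ vanishing on $Q$. Then $\beta$ is the finest locally convex topology on $C_b(Z)$ that is coarser than $\beta_Q$ for every such $Q$. *)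

theory Defs
  imports "HOL-Analysis.Analysis"
begin

section \<open>The Stone-Cech compactification\<close>

text \<open>
  The compactification of \<open>Z\<close> is realised as the closure of the image of \<open>Z\<close> under
  evaluation in the product of copies of the reals indexed by \<open>C\<^sub>b(Z)\<close>. The closure is compact
  because the coordinate indexed by \<open>f\<close> stays in \<open>[- norm f, norm f]\<close>.
\<close>

definition sc_embed :: "'z::topological_space \<Rightarrow> (('z \<Rightarrow>\<^sub>C real) \<Rightarrow> real)" where
  "sc_embed z = (\<lambda>f. apply_bcontfun f z)"

definition stone_cech :: "(('z::topological_space \<Rightarrow>\<^sub>C real) \<Rightarrow> real) set" where
  "stone_cech = closure (range sc_embed)"

lemma sc_embed_in_stone_cech: "sc_embed z \<in> stone_cech"
  unfolding stone_cech_def by (rule subsetD[OF closure_subset rangeI])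

lemma continuous_on_sc_embed: "continuous_on S sc_embed"
proof (rule continuous_on_coordinatewise_then_product)
  show "continuous_on S (\<lambda>z. sc_embed z f)" for f
    unfolding sc_embed_def by (rule continuous_on_apply_bcontfun)
qed

lemma compact_stone_cech: "compact (stone_cech :: (('z::topological_space \<Rightarrow>\<^sub>C real) \<Rightarrow> real) set)"
proof -
  let ?K = "\<Pi>\<^sub>E f\<in>UNIV. {- norm (f :: 'z \<Rightarrow>\<^sub>C real) .. norm f}"
  have "compactin (product_topology (\<lambda>_. euclidean) UNIV) ?K"
    by (simp add: compactin_PiE)
  then have K: "compact ?K"
    by (simp add: euclidean_product_topology)
  have "range sc_embed \<subseteq> ?K"
  proof -
    have "- norm f \<le> apply_bcontfun f z \<and> apply_bcontfun f z \<le> norm f" for f :: "'z \<Rightarrow>\<^sub>C real" and z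
      using norm_bounded[of f z] by (simp add: abs_le_iff)
    then show ?thesis
      by (auto simp: sc_embed_def)
  qed
  moreover have "closed ?K"
    using closedin_product_topology[of "\<lambda>_. euclidean" UNIV "\<lambda>f. {- norm (f :: 'z \<Rightarrow>\<^sub>C real) .. norm f}"]
    by (simp add: euclidean_product_topology)
  ultimately have "stone_cech \<subseteq> ?K"
    unfolding stone_cech_def by (rule closure_minimal)
  then have "?K \<inter> stone_cech = (stone_cech :: (('z \<Rightarrow>\<^sub>C real) \<Rightarrow> real) set)"
    by blast
  then show ?thesis
    using compact_Int_closed[OF K, of stone_cech] by (simp add: stone_cech_def)
qed

lemma stone_cech_extension:
  fixes f :: "'z::topological_space \<Rightarrow>\<^sub>C real"
  shows "\<exists>h. continuous_on stone_cech h \<and> (\<forall>z. h (sc_embed z) = apply_bcontfun f z)"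
proof -
  have "continuous_on stone_cech (\<lambda>x. x f)"
    by (rule continuous_on_product_then_coordinatewise) (rule continuous_on_id)
  then show ?thesis
    by (intro exI[of _ "\<lambda>x. x f"]) (simp add: sc_embed_def)
qed

lemma embedding_sc_embed:
  "embedding_map euclidean euclidean (sc_embed :: 'z::metric_space \<Rightarrow> _)"
proof -
  have dist_bc: "(\<lambda>x. min 1 (dist x a)) \<in> bcontfun" for a :: 'z
    by (rule bcontfun_normI[where b = 1]) (auto intro!: continuous_intros)
  define d where "d a = Bcontfun (\<lambda>x. min 1 (dist x a))" for a :: 'z
  have d: "apply_bcontfun (d a) x = min 1 (dist x a)" for a x
    unfolding d_def using dist_bc[of a] by (simp add: Bcontfun_inverse)
  have inj: "inj (sc_embed :: 'z \<Rightarrow> _)"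
  proof (rule injI)
    fix x y :: 'z
    assume "sc_embed x = sc_embed y"
    then have "apply_bcontfun (d y) x = apply_bcontfun (d y) y"
      by (metis sc_embed_def)
    then show "x = y"
      by (simp add: d min_def split: if_splits)
  qed
  let ?R = "range (sc_embed :: 'z \<Rightarrow> _)"
  have "continuous_on ?R (inv sc_embed)"
    unfolding continuous_on_topological
  proof (intro ballI allI impI)
    fix p and B :: "'z set"
    assume "p \<in> ?R" "open B" and pB: "inv sc_embed p \<in> B"
    then obtain a where p: "p = sc_embed a"
      by blast
    then have "a \<in> B"
      using pB inj by simp
    then obtain e where e: "e > 0" "ball a e \<subseteq> B"
      using \<open>open B\<close> open_contains_ball by blast
    let ?A = "(\<lambda>x. x (d a)) -` {..< min 1 e}"
    have "continuous_on UNIV (\<lambda>x :: ('z \<Rightarrow>\<^sub>C real) \<Rightarrow> real. x (d a))"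
      by (rule continuous_on_product_then_coordinatewise) (rule continuous_on_id)
    then have "open ?A"
      by (intro open_vimage open_lessThan)
    moreover have "p \<in> ?A"
      using e by (simp add: p sc_embed_def d)
    moreover have "\<forall>y\<in>?R. y \<in> ?A \<longrightarrow> inv sc_embed y \<in> B"
    proof (intro ballI impI)
      fix y assume "y \<in> ?R" and yA: "y \<in> ?A"
      then obtain z where z: "y = sc_embed z"
        by blast
      have "min 1 (dist z a) < min 1 e"
        using yA by (simp add: z sc_embed_def d)
      then have "dist z a < e"
        by linarith
      then have "z \<in> B"
        using e(2) by (auto simp: dist_commute)
      then show "inv sc_embed y \<in> B"
        by (simp add: z inv_f_f[OF inj])
    qed
    ultimately show "\<exists>A. open A \<and> p \<in> A \<and> (\<forall>y\<in>?R. y \<in> A \<longrightarrow> inv sc_embed y \<in> B)"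
      by blast
  qed
  then have "homeomorphic_maps euclidean (top_of_set ?R) (sc_embed :: 'z \<Rightarrow> _) (inv sc_embed)"
    unfolding homeomorphic_maps_def
    using inj continuous_on_sc_embed[of "UNIV :: 'z set"]
    by (simp add: continuous_map_in_subtopology f_inv_into_f)
  then show ?thesis
    unfolding embedding_map_def homeomorphic_map_maps by (intro exI[of _ "inv sc_embed"]) simp
qed

section \<open>Locally convex topologies\<close>

text \<open>Hausdorffness is not part of the notion.\<close>

definition locally_convex_topology :: "'v::real_vector topology \<Rightarrow> bool" where
  "locally_convex_topology \<tau> \<longleftrightarrow>
     topspace \<tau> = UNIV \<and>
     continuous_map (prod_topology \<tau> \<tau>) \<tau> (\<lambda>(x, y). x + y) \<and>
     continuous_map (prod_topology euclideanreal \<tau>) \<tau> (\<lambda>(c, x). c *\<^sub>R x) \<and>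
     (\<forall>U. openin \<tau> U \<and> 0 \<in> U \<longrightarrow> (\<exists>V. openin \<tau> V \<and> convex V \<and> 0 \<in> V \<and> V \<subseteq> U))"

definition coarser_topology :: "'v topology \<Rightarrow> 'v topology \<Rightarrow> bool" where
  "coarser_topology \<sigma> \<tau> \<longleftrightarrow> (\<forall>U. openin \<sigma> U \<longrightarrow> openin \<tau> U)"

definition seminorm_topology :: "('v::real_vector \<Rightarrow> real) set \<Rightarrow> 'v topology" where
  "seminorm_topology P = topology_generated_by {{g. p (g - f) < e} | p f e. p \<in> P \<and> e > 0}"

section \<open>The strict topology\<close>

definition strict_seminorm ::
    "((('z::topological_space \<Rightarrow>\<^sub>C real) \<Rightarrow> real) \<Rightarrow> real) \<Rightarrow> ('z \<Rightarrow>\<^sub>C real) \<Rightarrow> real" where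
  "strict_seminorm h f = (SUP z. \<bar>h (sc_embed z) * apply_bcontfun f z\<bar>)"

definition beta_Q ::
    "(('z::topological_space \<Rightarrow>\<^sub>C real) \<Rightarrow> real) set \<Rightarrow> ('z \<Rightarrow>\<^sub>C real) topology" where
  "beta_Q Q = seminorm_topology
     {strict_seminorm h | h. continuous_on stone_cech h \<and> (\<forall>q\<in>Q. h q = 0)}"

definition remainder_compacts :: "(('z::topological_space \<Rightarrow>\<^sub>C real) \<Rightarrow> real) set set" where
  "remainder_compacts = {Q. compact Q \<and> Q \<subseteq> stone_cech - range sc_embed}"

definition strict_candidates :: "('z::topological_space \<Rightarrow>\<^sub>C real) topology set" where
  "strict_candidates = {\<tau>. locally_convex_topology \<tau> \<and>
     (\<forall>Q\<in>remainder_compacts. coarser_topology \<tau> (beta_Q Q))}"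

text \<open>
  The finest candidate is obtained as the supremum of all candidates; the theorem
  \<open>strict_topology_finest\<close> below shows that this supremum is itself a candidate.
\<close>

definition strict_topology :: "('z::topological_space \<Rightarrow>\<^sub>C real) topology" where
  "strict_topology = topology_generated_by {U. \<exists>\<tau>\<in>strict_candidates. openin \<tau> U}"

lemma bdd_above_strict_seminorm:
  fixes f :: "'z::topological_space \<Rightarrow>\<^sub>C real"
  assumes "continuous_on stone_cech h"
  shows "bdd_above (range (\<lambda>z. \<bar>h (sc_embed z) * apply_bcontfun f z\<bar>))"
proof -
  have "bounded (h ` stone_cech)"
    using assms compact_stone_cech compact_continuous_image compact_imp_bounded by blast
  then obtain B where B: "\<And>x. x \<in> stone_cech \<Longrightarrow> \<bar>h x\<bar> \<le> B"
    unfolding bounded_real by blast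
  have "\<bar>h (sc_embed z) * apply_bcontfun f z\<bar> \<le> B * norm f" for z
    unfolding abs_mult
    using B[OF sc_embed_in_stone_cech, of z] norm_bounded[of f z]
    by (intro mult_mono) (auto intro: order_trans[OF abs_ge_zero])
  then show ?thesis
    by (intro bdd_aboveI2)
qed

lemma locally_convex_topology_Sup:
  fixes C :: "'v::real_vector topology set"
  assumes lc: "\<And>\<tau>. \<tau> \<in> C \<Longrightarrow> locally_convex_topology \<tau>" and ne: "C \<noteq> {}"
  shows "locally_convex_topology (topology_generated_by {U. \<exists>\<tau>\<in>C. openin \<tau> U})"
proof -
  let ?S = "{U. \<exists>\<tau>\<in>C. openin \<tau> U}"
  let ?s = "topology_generated_by ?S"
  have sp: "topspace \<tau> = UNIV" if "\<tau> \<in> C" for \<tau>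
    using lc[OF that] by (simp add: locally_convex_topology_def)
  then have "UNIV \<in> ?S"
    using ne openin_topspace by (metis (mono_tags, lifting) all_not_in_conv mem_Collect_eq)
  then have top: "topspace ?s = UNIV"
    by auto
  have op: "openin ?s U" if "\<tau> \<in> C" "openin \<tau> U" for \<tau> U
    using that by (intro topology_generated_by_Basis) auto
  have idm: "continuous_map ?s \<tau> (\<lambda>x. x)" if "\<tau> \<in> C" for \<tau>
    using op[OF that] sp[OF that] top
    by (simp add: continuous_map_alt del: topology_generated_by_topspace)
  have into: "continuous_map T ?s f" if "\<And>\<tau>. \<tau> \<in> C \<Longrightarrow> continuous_map T \<tau> f"
    for T :: "'c topology" and f
  proof (rule continuous_on_generated_topo)
    show "openin T (f -` U \<inter> topspace T)" if "U \<in> ?S" for U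
      using that \<open>\<And>\<tau>. \<tau> \<in> C \<Longrightarrow> continuous_map T \<tau> f\<close> continuous_map_alt by blast
    show "f ` topspace T \<subseteq> \<Union> ?S"
      using \<open>UNIV \<in> ?S\<close> by blast
  qed
  have add: "continuous_map (prod_topology ?s ?s) ?s (\<lambda>(x, y). x + y)"
  proof (rule into)
    fix \<tau> assume \<tau>: "\<tau> \<in> C"
    have "continuous_map (prod_topology ?s ?s) (prod_topology \<tau> \<tau>) (\<lambda>(x, y). (x, y))"
      by (subst continuous_map_prod_top) (use idm[OF \<tau>] in simp)
    moreover have "continuous_map (prod_topology \<tau> \<tau>) \<tau> (\<lambda>(x, y). x + y)"
      using lc[OF \<tau>] by (simp add: locally_convex_topology_def)
    ultimately have "continuous_map (prod_topology ?s ?s) \<tau> ((\<lambda>(x, y). x + y) \<circ> (\<lambda>(x, y). (x, y)))"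
      by (rule continuous_map_compose)
    then show "continuous_map (prod_topology ?s ?s) \<tau> (\<lambda>(x, y). x + y)"
      by (simp add: o_def case_prod_unfold)
  qed
  have scale: "continuous_map (prod_topology euclideanreal ?s) ?s (\<lambda>(c, x). c *\<^sub>R x)"
  proof (rule into)
    fix \<tau> assume \<tau>: "\<tau> \<in> C"
    have "continuous_map (prod_topology euclideanreal ?s) (prod_topology euclideanreal \<tau>) (\<lambda>(x, y). (x, y))"
      by (subst continuous_map_prod_top) (use idm[OF \<tau>] in simp)
    moreover have "continuous_map (prod_topology euclideanreal \<tau>) \<tau> (\<lambda>(c, x). c *\<^sub>R x)"
      using lc[OF \<tau>] by (simp add: locally_convex_topology_def)
    ultimately have "continuous_map (prod_topology euclideanreal ?s) \<tau> ((\<lambda>(c, x). c *\<^sub>R x) \<circ> (\<lambda>(x, y). (x, y)))"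
      by (rule continuous_map_compose)
    then show "continuous_map (prod_topology euclideanreal ?s) \<tau> (\<lambda>(c, x). c *\<^sub>R x)"
      by (simp add: o_def case_prod_unfold)
  qed
  have transl: "openin \<tau> ((\<lambda>y. a + y) -` U)" if "\<tau> \<in> C" "openin \<tau> U" for \<tau> a U
  proof -
    have "continuous_map \<tau> (prod_topology \<tau> \<tau>) (\<lambda>y. (a, y))"
      using sp[OF that(1)] by (auto simp: continuous_map_pairwise o_def)
    moreover have "continuous_map (prod_topology \<tau> \<tau>) \<tau> (\<lambda>(x, y). x + y)"
      using lc[OF that(1)] by (simp add: locally_convex_topology_def)
    ultimately have "continuous_map \<tau> \<tau> ((\<lambda>(x, y). x + y) \<circ> (\<lambda>y. (a, y)))"
      by (rule continuous_map_compose)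
    then have "continuous_map \<tau> \<tau> (\<lambda>y. a + y)"
      by (simp add: o_def)
    then show ?thesis
      using that sp[OF that(1)] by (simp add: continuous_map_alt)
  qed
  have conv: "\<forall>x\<in>U. \<exists>V. openin ?s V \<and> convex V \<and> x \<in> V \<and> V \<subseteq> U"
    if "generate_topology_on ?S U" for U
    using that
  proof induction
    case Empty
    then show ?case by simp
  next
    case (Int A B)
    show ?case
    proof
      fix x assume "x \<in> A \<inter> B"
      then have "x \<in> A" "x \<in> B"
        by auto
      obtain V where "openin ?s V" "convex V" "x \<in> V" "V \<subseteq> A"
        using Int.IH(1) \<open>x \<in> A\<close> by meson
      moreover obtain W where "openin ?s W" "convex W" "x \<in> W" "W \<subseteq> B"
        using Int.IH(2) \<open>x \<in> B\<close> by meson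
      ultimately show "\<exists>V. openin ?s V \<and> convex V \<and> x \<in> V \<and> V \<subseteq> A \<inter> B"
        by (intro exI[of _ "V \<inter> W"] conjI openin_Int convex_Int IntI Int_mono)
    qed
  next
    case (UN K)
    show ?case
    proof
      fix x assume "x \<in> \<Union> K"
      then obtain k where "k \<in> K" "x \<in> k"
        by blast
      then obtain V where "openin ?s V" "convex V" "x \<in> V" "V \<subseteq> k"
        using UN.IH by meson
      then show "\<exists>V. openin ?s V \<and> convex V \<and> x \<in> V \<and> V \<subseteq> \<Union> K"
        using \<open>k \<in> K\<close> by (intro exI[of _ V]) auto
    qed
  next
    case (Basis U)
    then obtain \<tau> where \<tau>: "\<tau> \<in> C" "openin \<tau> U"
      by blast
    show ?case
    proof
      fix x assume "x \<in> U"
      then have "0 \<in> (\<lambda>y. x + y) -` U"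
        by simp
      then obtain V where V: "openin \<tau> V" "convex V" "0 \<in> V" "V \<subseteq> (\<lambda>y. x + y) -` U"
        using lc[OF \<tau>(1)] transl[OF \<tau>, of x] unfolding locally_convex_topology_def by blast
      have eq: "(\<lambda>y. x + y) ` V = (\<lambda>y. - x + y) -` V"
        proof (intro equalityI subsetI)
        fix z assume "z \<in> (\<lambda>y. - x + y) -` V"
        then have "- x + z \<in> V" "z = x + (- x + z)"
          by simp_all
        then show "z \<in> (\<lambda>y. x + y) ` V"
          by blast
      qed (auto simp: add.assoc[symmetric])
      have "openin ?s ((\<lambda>y. x + y) ` V)"
        unfolding eq by (rule op[OF \<tau>(1) transl[OF \<tau>(1) V(1)]])
      moreover have "convex ((\<lambda>y. x + y) ` V)"
        using V(2) by (rule convex_translation)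
      moreover have "x \<in> (\<lambda>y. x + y) ` V"
        using V(3) by (intro image_eqI[of _ _ 0]) auto
      moreover have "(\<lambda>y. x + y) ` V \<subseteq> U"
        using V(4) by blast
      ultimately show "\<exists>W. openin ?s W \<and> convex W \<and> x \<in> W \<and> W \<subseteq> U"
        by (intro exI conjI)
    qed
  qed
  show ?thesis
    unfolding locally_convex_topology_def
  proof (intro conjI allI impI)
    fix U assume "openin ?s U \<and> 0 \<in> U"
    then show "\<exists>V. openin ?s V \<and> convex V \<and> 0 \<in> V \<and> V \<subseteq> U"
      using conv[OF openin_topology_generated_by] by blast
  qed (rule top add scale)+
qed

lemma locally_convex_topology_indiscrete:
  "locally_convex_topology (topology_generated_by {UNIV :: 'v::real_vector set})"
proof -
  let ?i = "topology_generated_by {UNIV :: 'v set}"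
  have op: "U = {} \<or> U = UNIV" if "openin ?i U" for U
    using that unfolding openin_topology_generated_by_iff
    by induction auto
  have top: "topspace ?i = UNIV"
    by simp
  have cont: "continuous_map T ?i f" for T :: "'c topology" and f
    by (rule continuous_on_generated_topo) auto
  show ?thesis
    unfolding locally_convex_topology_def
    using top op cont convex_UNIV by (metis empty_iff subset_UNIV openin_topspace)
qed

theorem strict_topology_finest:
  shows "strict_topology \<in> (strict_candidates :: ('z::topological_space \<Rightarrow>\<^sub>C real) topology set)"
    and "\<tau> \<in> strict_candidates \<Longrightarrow> coarser_topology \<tau> (strict_topology :: ('z \<Rightarrow>\<^sub>C real) topology)"
proof -
  let ?C = "strict_candidates :: ('z \<Rightarrow>\<^sub>C real) topology set"
  let ?i = "topology_generated_by {UNIV :: ('z \<Rightarrow>\<^sub>C real) set}"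
  have UNIV_beta: "openin (beta_Q Q) UNIV" for Q :: "(('z \<Rightarrow>\<^sub>C real) \<Rightarrow> real) set"
  proof -
    have "strict_seminorm (\<lambda>_. 0) \<in> {strict_seminorm h | h. continuous_on stone_cech h \<and> (\<forall>q\<in>Q. h q = 0)}"
      by (intro CollectI exI[of _ "\<lambda>_. 0"]) auto
    moreover have "UNIV = {g :: 'z \<Rightarrow>\<^sub>C real. strict_seminorm (\<lambda>_. 0) (g - 0) < 1}"
      by (auto simp: strict_seminorm_def)
    ultimately show ?thesis
      unfolding beta_Q_def seminorm_topology_def
      by (intro topology_generated_by_Basis CollectI exI conjI) (assumption | simp)+
  qed
  have "coarser_topology ?i (beta_Q Q)" for Q :: "(('z \<Rightarrow>\<^sub>C real) \<Rightarrow> real) set"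
    unfolding coarser_topology_def openin_topology_generated_by_iff
  proof (intro allI impI)
    fix U :: "('z \<Rightarrow>\<^sub>C real) set"
    assume "generate_topology_on {UNIV} U"
    then show "openin (beta_Q Q) U"
      by induction (auto simp: UNIV_beta)
  qed
  then have "?i \<in> ?C"
    by (simp add: strict_candidates_def locally_convex_topology_indiscrete)
  then have "locally_convex_topology (strict_topology :: ('z \<Rightarrow>\<^sub>C real) topology)"
    unfolding strict_topology_def
    by (intro locally_convex_topology_Sup) (auto simp: strict_candidates_def)
  moreover have "coarser_topology strict_topology (beta_Q Q)" if "Q \<in> remainder_compacts"
    for Q :: "(('z \<Rightarrow>\<^sub>C real) \<Rightarrow> real) set"
    unfolding coarser_topology_def strict_topology_def openin_topology_generated_by_iff
  proof (intro allI impI)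
    fix U :: "('z \<Rightarrow>\<^sub>C real) set"
    assume "generate_topology_on {U. \<exists>\<tau>\<in>?C. openin \<tau> U} U"
    then show "openin (beta_Q Q) U"
      by induction (use that in \<open>auto simp: strict_candidates_def coarser_topology_def\<close>)
  qed
  ultimately show "strict_topology \<in> ?C"
    by (simp add: strict_candidates_def)
  show "coarser_topology \<tau> strict_topology" if "\<tau> \<in> ?C"
    unfolding coarser_topology_def strict_topology_def
    using that by (auto intro: topology_generated_by_Basis)
qed

end

theory Submission
  imports Defs
begin

text \<open>
  Since \<open>\<beta>\<close> is coarser than the norm topology, the Banach closed graph theorem makes \<open>T\<close> norm
  bounded. The heart of the proof is an Orlicz--Pettis argument. Let \<open>f n\<close> be a sequence in
  \<open>C\<^sub>b(X)\<close> that is locally eventually zero and has pointwise uniformly bounded variation, and let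
  \<open>g n = f n - f (n + 1)\<close>. Then \<open>A \<mapsto> T (\<Sum>n\<in>A. g n)\<close> is a bounded finitely additive set function on the
  subsets of the natural numbers with values in \<open>C\<^sub>b(Y)\<close>. Evaluated at a point of \<open>Y\<close>, it is the sum of a
  countably additive part \<open>\<Sum>n\<in>A. u n y\<close>, where \<open>u n = T (g n)\<close>, and a part vanishing on finite sets. The latter
  vanishes on all but countably many members of an uncountable almost disjoint family, so a gliding
  hump along a convergent sequence of points shows that \<open>y \<mapsto> (u n y)\<^sub>n\<close> is continuous into
  \<open>\<ell>\<^sup>1\<close>. Dini's theorem for \<open>\<beta>\<close> then gives strict convergence of \<open>\<Sum>n. u n\<close>, the closed graph
  identifies the sum, and \<open>T (f n)\<close> tends strictly to zero.

  For the continuity of \<open>T\<close> it suffices that \<open>T\<close> is continuous from each \<open>\<beta>\<^sub>Q\<close>. By the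
  Lindelof property there is a continuous function on the compactification that vanishes on \<open>Q\<close>
  and is positive on \<open>X\<close>; truncating along its level sets reduces the claim to sequences as above.
\<close>

section \<open>The closed graph theorem for Banach spaces\<close>

text \<open>Baire's theorem puts a ball inside the closure of some sublevel set of
  \<open>norm (T x)\<close>, and differences move it to the origin. Every \<open>x\<close> is then
  approximated by points with controlled image; summing successive corrections gives a series whose
  image the closed graph identifies with \<open>T x\<close>.\<close>

theorem closed_graph_bounded:
  fixes T :: "'a::banach \<Rightarrow> 'b::banach"
  assumes lin: "linear T"
    and cg: "\<And>x l m. x \<longlonglongrightarrow> l \<Longrightarrow> (\<lambda>n. T (x n)) \<longlonglongrightarrow> m \<Longrightarrow> T l = m"
  obtains K where "K \<ge> 0" "\<And>x. norm (T x) \<le> K * norm x"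
proof -
  define C where "C k = closure {x. norm (T x) \<le> real k}" for k :: nat
  have "\<exists>k. interior (C k) \<noteq> {}"
  proof (rule ccontr)
    assume "\<nexists>k. interior (C k) \<noteq> {}"
    then have "euclidean interior_of (\<Union> (range C)) = {}"
      by (intro Baire_category_alt) (auto simp: C_def completely_metrizable_space_euclidean)
    moreover have "\<Union> (range C) = UNIV"
    proof -
      have "x \<in> C (nat \<lceil>norm (T x)\<rceil>)" for x
        unfolding C_def by (rule subsetD[OF closure_subset]) (simp add: real_nat_ceiling_ge)
      then show ?thesis
        by blast
    qed
    ultimately show False
      by simp
  qed
  then obtain k x0 where "x0 \<in> interior (C k)"
    by blast
  then obtain r where r: "r > 0" "cball x0 r \<subseteq> C k"
    by (meson mem_interior_cball)
  \<comment> \<open>With \<open>c = r / norm x\<close> both \<open>x0\<close> and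
    \<open>x0 + c *\<^sub>R x\<close> lie in the ball; subtracting their approximants and dividing
    by \<open>c\<close> costs \<open>2 * k / c\<close>.\<close>
  define K where "K = 2 * real k / r"
  have K0: "K \<ge> 0"
    using r by (simp add: K_def)
  have near: "\<exists>x'. norm (T x') \<le> real k \<and> norm (z - x') < d" if "z \<in> cball x0 r" "d > 0" for z d
  proof -
    have "z \<in> closure {x. norm (T x) \<le> real k}"
      using that r by (auto simp: C_def)
    then show ?thesis
      using \<open>d > 0\<close> unfolding closure_approachable by (metis dist_commute dist_norm mem_Collect_eq)
  qed
  have approx: "\<exists>x'. norm (T x') \<le> K * norm x \<and> norm (x - x') < d" if "d > 0" for x d
  proof (cases "x = 0")
    case True
    then show ?thesis
      using that linear_0[OF lin] by (intro exI[of _ 0]) simp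
  next
    case False
    define c where "c = r / norm x"
    have c: "c > 0"
      using False r by (simp add: c_def)
    have pos: "c * d / 2 > 0" and in0: "x0 \<in> cball x0 r" and in1: "x0 + c *\<^sub>R x \<in> cball x0 r"
      using c that False r by (auto simp: c_def dist_norm)
    obtain a where a: "norm (T a) \<le> real k" "norm (x0 + c *\<^sub>R x - a) < c * d / 2"
      using near[OF in1 pos] by blast
    obtain b where b: "norm (T b) \<le> real k" "norm (x0 - b) < c * d / 2"
      using near[OF in0 pos] by blast
    have "norm (T (a - b)) \<le> 2 * real k"
      using a b norm_triangle_ineq4[of "T a" "T b"] by (simp add: linear_diff[OF lin])
    then have "norm (T ((1 / c) *\<^sub>R (a - b))) \<le> K * norm x"
      using mult_left_mono[of "norm (T (a - b))" "2 * real k" "norm x / r"] r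
      by (simp add: linear_scale[OF lin] K_def c_def mult.commute)
    moreover have "norm (x - (1 / c) *\<^sub>R (a - b)) < d"
    proof -
      have "c *\<^sub>R (x - (1 / c) *\<^sub>R (a - b)) = (x0 + c *\<^sub>R x - a) - (x0 - b)"
        using c by (simp add: algebra_simps)
      then have "c * norm (x - (1 / c) *\<^sub>R (a - b)) = norm ((x0 + c *\<^sub>R x - a) - (x0 - b))"
        using c by (metis abs_of_pos norm_scaleR)
      also have "\<dots> < c * d"
        using a b norm_triangle_ineq4[of "x0 + c *\<^sub>R x - a" "x0 - b"] by simp
      finally show ?thesis
        using c by simp
    qed
    ultimately show ?thesis
      by blast
  qed
  have "norm (T x) \<le> 2 * K * norm x" for x
  proof (cases "x = 0")
    case True
    then show ?thesis
      by (simp add: linear_0[OF lin])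
  next
    case False
    define N where "N = norm x"
    have N: "N > 0"
      using False by (simp add: N_def)
    obtain s where s: "\<And>n z. norm (T (s n z)) \<le> K * norm z \<and> norm (z - s n z) < N * (1 / 2) ^ Suc n"
      using approx[of "N * (1 / 2) ^ Suc n" for n] N by (metis zero_less_divide_1_iff zero_less_mult_iff zero_less_numeral zero_less_power)
    \<comment> \<open>\<open>z n\<close> is the residual after \<open>n\<close> corrections. It is
      at most \<open>N / 2 ^ n\<close>, so the images of the corrections are bounded by a geometric
      series with sum \<open>2 * K * N\<close>.\<close>
    define z where "z = rec_nat x (\<lambda>n z. z - s n z)"
    have z: "z 0 = x" "z (Suc n) = z n - s n (z n)" for n
      by (simp_all add: z_def)
    have nz: "norm (z n) \<le> N * (1 / 2) ^ n" for n
    proof (cases n)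
      case (Suc m)
      then show ?thesis
        using s[of m "z m"] by (simp add: z less_imp_le)
    qed (simp add: z N_def)
    have nT: "norm (T (s n (z n))) \<le> K * N * (1 / 2) ^ n" for n
      using s[of n "z n"] mult_left_mono[OF nz K0, of n] by (simp add: mult.assoc)
    have geo: "(\<lambda>n. K * N * (1 / 2) ^ n) sums (2 * K * N)"
      using sums_mult[OF geometric_sums[of "1 / 2 :: real"], of "K * N"] by (simp add: mult_ac)
    have sum_z: "(\<Sum>i<n. s i (z i)) = x - z n" for n
      by (induction n) (simp_all add: z)
    have "z \<longlonglongrightarrow> 0"
    proof (rule Lim_null_comparison[of _ "\<lambda>n. N * (1 / 2) ^ n"])
      show "(\<lambda>n. N * (1 / 2) ^ n) \<longlonglongrightarrow> 0"
        by (intro tendsto_mult_right_zero LIMSEQ_power_zero) simp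
    qed (use nz in simp)
    then have "(\<lambda>n. x - z n) \<longlonglongrightarrow> x"
      using tendsto_diff[OF tendsto_const, of z 0 sequentially x] by simp
    moreover have "summable (\<lambda>n. T (s n (z n)))"
      by (rule summable_comparison_test[OF _ sums_summable[OF geo]]) (use nT in auto)
    then have "(\<lambda>n. T (x - z n)) \<longlonglongrightarrow> (\<Sum>n. T (s n (z n)))"
      using summable_LIMSEQ by (simp add: sum_z[symmetric] linear_sum[OF lin])
    ultimately have "T x = (\<Sum>n. T (s n (z n)))"
      by (rule cg)
    also have "norm \<dots> \<le> (\<Sum>n. K * N * (1 / 2) ^ n)"
      by (rule norm_suminf_le[OF nT sums_summable[OF geo]])
    also have "\<dots> = 2 * K * N"
      using geo by (rule sums_unique[symmetric])
    finally show ?thesis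
      by (simp add: N_def)
  qed
  then show thesis
    using that[of "2 * K"] K0 by simp
qed

section \<open>Neighbourhoods of zero in the strict topology\<close>

lemma strict_seminorm_least:
  assumes "\<And>z. \<bar>h (sc_embed z) * apply_bcontfun f z\<bar> \<le> b"
  shows "strict_seminorm h f \<le> b"
  unfolding strict_seminorm_def by (rule cSUP_least) (use assms in auto)

lemma strict_seminorm_upper:
  assumes "continuous_on stone_cech h"
  shows "\<bar>h (sc_embed z) * apply_bcontfun f z\<bar> \<le> strict_seminorm h f"
  unfolding strict_seminorm_def by (rule cSUP_upper[OF _ bdd_above_strict_seminorm[OF assms]]) simp

lemma strict_seminorm_mono:
  assumes "continuous_on stone_cech k" "\<And>q. \<bar>h q\<bar> \<le> \<bar>k q\<bar>"
  shows "strict_seminorm h f \<le> strict_seminorm k f"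
proof (rule strict_seminorm_least)
  fix z
  have "\<bar>h (sc_embed z) * apply_bcontfun f z\<bar> \<le> \<bar>k (sc_embed z) * apply_bcontfun f z\<bar>"
    by (simp add: abs_mult mult_right_mono assms)
  then show "\<bar>h (sc_embed z) * apply_bcontfun f z\<bar> \<le> strict_seminorm k f"
    using strict_seminorm_upper[OF assms(1), of z f] by linarith
qed

lemma strict_seminorm_add:
  assumes "continuous_on stone_cech h"
  shows "strict_seminorm h (f + g) \<le> strict_seminorm h f + strict_seminorm h g"
proof (rule strict_seminorm_least)
  fix z
  show "\<bar>h (sc_embed z) * apply_bcontfun (f + g) z\<bar> \<le> strict_seminorm h f + strict_seminorm h g"
    using strict_seminorm_upper[OF assms, of z f] strict_seminorm_upper[OF assms, of z g]
    by (simp add: distrib_left)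
qed

text \<open>Weights can be merged: \<open>\<bar>h1 q\<bar> + \<bar>h2 q\<bar>\<close> dominates both
  and still vanishes on \<open>Q\<close>, so a single weighted ball fits into a finite intersection
  of subbasic sets. Other centres are handled by the triangle inequality.\<close>

lemma openin_beta_Q_imp_ball:
  fixes U :: "('z::topological_space \<Rightarrow>\<^sub>C real) set"
  assumes "openin (beta_Q Q) U" "f \<in> U"
  obtains h e where "continuous_on stone_cech h" "\<forall>q\<in>Q. h q = 0" "e > 0"
    "\<And>g. strict_seminorm h (g - f) < e \<Longrightarrow> g \<in> U"
proof -
  let ?P = "\<lambda>U f h e. continuous_on stone_cech h \<and> (\<forall>q\<in>Q. h q = 0) \<and> e > (0::real) \<and>
    (\<forall>g. strict_seminorm h (g - f) < e \<longrightarrow> g \<in> U)"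
  have "\<forall>f\<in>U. \<exists>h e. ?P U f h e"
    using assms(1) unfolding beta_Q_def seminorm_topology_def openin_topology_generated_by_iff
  proof induction
    case Empty
    then show ?case by simp
  next
    case (Int A B)
    show ?case
    proof
      fix f assume "f \<in> A \<inter> B"
      then have f: "f \<in> A" "f \<in> B"
        by simp_all
      obtain h1 e1 where 1: "?P A f h1 e1"
        using bspec[OF Int.IH(1) f(1)] by (elim exE) (rule that)
      obtain h2 e2 where 2: "?P B f h2 e2"
        using bspec[OF Int.IH(2) f(2)] by (elim exE) (rule that)
      let ?h = "\<lambda>q. \<bar>h1 q\<bar> + \<bar>h2 q\<bar>"
      have c: "continuous_on stone_cech ?h"
        using 1 2 by (intro continuous_intros) auto
      have le: "strict_seminorm h1 g \<le> strict_seminorm ?h g" "strict_seminorm h2 g \<le> strict_seminorm ?h g" for g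
        by (rule strict_seminorm_mono[OF c]; simp)+
      have "g \<in> A \<inter> B" if "strict_seminorm ?h (g - f) < min e1 e2" for g
      proof
        show "g \<in> A"
          using 1 le_less_trans[OF le(1)[of "g - f"]] that by simp
        show "g \<in> B"
          using 2 le_less_trans[OF le(2)[of "g - f"]] that by simp
      qed
      moreover have "\<forall>q\<in>Q. ?h q = 0" "min e1 e2 > 0"
        using 1 2 by simp_all
      ultimately have "?P (A \<inter> B) f ?h (min e1 e2)"
        using c by blast
      then show "\<exists>h e. ?P (A \<inter> B) f h e"
        by (intro exI)
    qed
  next
    case (UN K)
    show ?case
    proof
      fix f assume "f \<in> \<Union> K"
      then obtain k where k: "k \<in> K" "f \<in> k"
        by blast
      obtain h e where "?P k f h e"
        using bspec[OF UN.IH[OF k(1)] k(2)] by (elim exE) (rule that)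
      then have "?P (\<Union> K) f h e"
        using k by blast
      then show "\<exists>h e. ?P (\<Union> K) f h e"
        by (intro exI)
    qed
  next
    case (Basis U)
    then obtain h f0 e where h: "continuous_on stone_cech h" "\<forall>q\<in>Q. h q = 0" "e > 0"
      and U: "U = {g. strict_seminorm h (g - f0) < e}"
      by blast
    show ?case
    proof
      fix f assume f: "f \<in> U"
      have "g \<in> U" if "strict_seminorm h (g - f) < e - strict_seminorm h (f - f0)" for g
        using strict_seminorm_add[OF h(1), of "g - f" "f - f0"] that by (simp add: U)
      then have "?P U f h (e - strict_seminorm h (f - f0))"
        using h f by (simp add: U)
      then show "\<exists>h e. ?P U f h e"
        by blast
    qed
  qed
  then show thesis
    using assms(2) that by blast
qed

lemma openin_beta_Q_ballI:
  fixes U :: "('z::topological_space \<Rightarrow>\<^sub>C real) set"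
  assumes "\<And>f. f \<in> U \<Longrightarrow> \<exists>h e. continuous_on stone_cech h \<and> (\<forall>q\<in>Q. h q = 0) \<and> e > 0 \<and>
    (\<forall>g. strict_seminorm h (g - f) < e \<longrightarrow> g \<in> U)"
  shows "openin (beta_Q Q) U"
proof (subst openin_subopen, intro ballI)
  fix f assume "f \<in> U"
  then obtain h e where h: "continuous_on stone_cech h" "\<forall>q\<in>Q. h q = 0" "e > 0"
    "\<forall>g. strict_seminorm h (g - f) < e \<longrightarrow> g \<in> U"
    using assms by blast
  have "strict_seminorm h 0 \<le> 0"
    by (rule strict_seminorm_least) simp
  then have "f \<in> {g. strict_seminorm h (g - f) < e}"
    using h(3) by simp
  moreover have "openin (beta_Q Q) {g. strict_seminorm h (g - f) < e}"
    unfolding beta_Q_def seminorm_topology_def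
    by (rule topology_generated_by_Basis) (use h in blast)
  ultimately show "\<exists>V. openin (beta_Q Q) V \<and> f \<in> V \<and> V \<subseteq> U"
    using h(4) by blast
qed

lemma openin_strict_imp_beta_Q:
  assumes "openin strict_topology U" "Q \<in> remainder_compacts"
  shows "openin (beta_Q Q) U"
  using strict_topology_finest(1) assms unfolding strict_candidates_def coarser_topology_def by blast

lemma empty_mem_remainder_compacts: "{} \<in> remainder_compacts"
  by (simp add: remainder_compacts_def)

lemma locally_convex_strict: "locally_convex_topology strict_topology"
  using strict_topology_finest(1) unfolding strict_candidates_def by blast

lemma topspace_strict: "topspace strict_topology = UNIV"
  using locally_convex_strict unfolding locally_convex_topology_def by blast

lemma strict_convex_nhd:
  assumes "openin strict_topology U" "0 \<in> U"
  obtains V where "openin strict_topology V" "convex V" "0 \<in> V" "V \<subseteq> U"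
  using locally_convex_strict assms unfolding locally_convex_topology_def by meson

lemma openin_locally_convex_translation:
  assumes "locally_convex_topology \<tau>" "openin \<tau> U"
  shows "openin \<tau> ((\<lambda>y. a + y) -` U)"
proof -
  have sp: "topspace \<tau> = UNIV"
    using assms(1) by (simp add: locally_convex_topology_def)
  have "continuous_map \<tau> (prod_topology \<tau> \<tau>) (\<lambda>y. (a, y))"
    using sp by (auto simp: continuous_map_pairwise o_def)
  moreover have "continuous_map (prod_topology \<tau> \<tau>) \<tau> (\<lambda>(x, y). x + y)"
    using assms(1) by (simp add: locally_convex_topology_def)
  ultimately have "continuous_map \<tau> \<tau> ((\<lambda>(x, y). x + y) \<circ> (\<lambda>y. (a, y)))"
    by (rule continuous_map_compose)
  then show ?thesis
    using assms sp by (simp add: continuous_map_alt o_def)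
qed

lemma openin_locally_convex_scaling:
  assumes "locally_convex_topology \<tau>" "openin \<tau> U"
  shows "openin \<tau> ((\<lambda>y. c *\<^sub>R y) -` U)"
proof -
  have sp: "topspace \<tau> = UNIV"
    using assms(1) by (simp add: locally_convex_topology_def)
  have "continuous_map \<tau> (prod_topology euclideanreal \<tau>) (\<lambda>y. (c, y))"
    using sp by (auto simp: continuous_map_pairwise o_def)
  moreover have "continuous_map (prod_topology euclideanreal \<tau>) \<tau> (\<lambda>(x, y). x *\<^sub>R y)"
    using assms(1) by (simp add: locally_convex_topology_def)
  ultimately have "continuous_map \<tau> \<tau> ((\<lambda>(x, y). x *\<^sub>R y) \<circ> (\<lambda>y. (c, y)))"
    by (rule continuous_map_compose)
  then show ?thesis
    using assms sp by (simp add: continuous_map_alt o_def)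
qed

text \<open>The comparison with the norm comes from \<open>Q = {}\<close>: a weight is bounded on
  the compact \<open>stone_cech\<close>, so its seminorm is at most a multiple of the norm.\<close>

lemma strict_nhd_norm:
  fixes U :: "('z::topological_space \<Rightarrow>\<^sub>C real) set"
  assumes "openin strict_topology U" "0 \<in> U"
  obtains d where "d > 0" "\<And>f. norm f \<le> d \<Longrightarrow> f \<in> U"
proof -
  obtain h :: "(('z \<Rightarrow>\<^sub>C real) \<Rightarrow> real) \<Rightarrow> real" and e where h: "continuous_on stone_cech h" "e > 0"
    "\<And>g. strict_seminorm h (g - 0) < e \<Longrightarrow> g \<in> U"
    using openin_beta_Q_imp_ball[OF openin_strict_imp_beta_Q[OF assms(1) empty_mem_remainder_compacts] assms(2)]
    by metis
  have "bounded (h ` stone_cech)"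
    using h(1) compact_stone_cech compact_continuous_image compact_imp_bounded by blast
  then obtain B where B: "B > 0" "\<And>x. x \<in> stone_cech \<Longrightarrow> \<bar>h x\<bar> \<le> B"
    unfolding bounded_pos by auto
  show thesis
  proof
    show "e / (2 * B) > 0"
      using B h by simp
    fix f :: "'z \<Rightarrow>\<^sub>C real" assume f: "norm f \<le> e / (2 * B)"
    have "strict_seminorm h f \<le> B * (e / (2 * B))"
    proof (rule strict_seminorm_least)
      fix z
      show "\<bar>h (sc_embed z) * apply_bcontfun f z\<bar> \<le> B * (e / (2 * B))"
        unfolding abs_mult
        using B(2)[OF sc_embed_in_stone_cech, of z] norm_bounded[of f z] f B(1)
        by (intro mult_mono) auto
    qed
    then show "f \<in> U"
      using h B by (intro h(3)) (simp add: field_simps)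
  qed
qed

text \<open>Convergence to zero on the space need not persist on the remainder. But the points of
  the compactification where all \<open>v n\<close> stay at least \<open>\<epsilon>\<close> form a
  compact \<open>Q\<close> inside the remainder, so the weight may be taken to vanish there; away
  from \<open>Q\<close> the usual compactness argument of Dini applies.\<close>

lemma strict_Dini:
  fixes p v :: "nat \<Rightarrow> 'z::topological_space \<Rightarrow>\<^sub>C real"
  assumes dec: "\<And>n z. v (Suc n) z \<le> v n z"
    and lim: "\<And>z. (\<lambda>n. v n z) \<longlonglongrightarrow> 0"
    and le: "\<And>n z. \<bar>p n z\<bar> \<le> v n z"
    and U: "openin strict_topology U" "0 \<in> U"
  shows "\<forall>\<^sub>F n in sequentially. p n \<in> U"
proof -
  obtain V where V: "openin strict_topology V" "convex V" "0 \<in> V" "V \<subseteq> U"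
    using strict_convex_nhd[OF U] by metis
  obtain d where d: "d > 0" "\<And>f. norm f \<le> d \<Longrightarrow> f \<in> V"
    using strict_nhd_norm[OF V(1,3)] by metis
  \<comment> \<open>Halving leaves room for writing \<open>p n\<close> as the mean of two doubled
    pieces, each put into the convex set \<open>V\<close>.\<close>
  define \<epsilon> where "\<epsilon> = d / 2"
  have \<epsilon>: "\<epsilon> > 0"
    using d by (simp add: \<epsilon>_def)
  have coord: "continuous_on S (\<lambda>q. q f)" for f and S :: "(('z \<Rightarrow>\<^sub>C real) \<Rightarrow> real) set"
    by (rule continuous_on_product_then_coordinatewise) (rule continuous_on_id)
  have cl: "closed (stone_cech :: (('z \<Rightarrow>\<^sub>C real) \<Rightarrow> real) set)"
    by (simp add: stone_cech_def)
  \<comment> \<open>The coordinate \<open>q (v n)\<close> is the continuous extension of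
    \<open>v n\<close> to the compactification; the inequality passes to it by density.\<close>
  have dec': "q (v (Suc n)) \<le> q (v n)" if "q \<in> stone_cech" for q n
  proof -
    have "closed {q :: ('z \<Rightarrow>\<^sub>C real) \<Rightarrow> real. q (v (Suc n)) \<le> q (v n)}"
      by (intro closed_Collect_le coord)
    then have "stone_cech \<subseteq> {q. q (v (Suc n)) \<le> q (v n)}"
      unfolding stone_cech_def by (intro closure_minimal) (auto simp: sc_embed_def dec)
    then show ?thesis
      using that by blast
  qed
  define Q where "Q = (\<Inter>n. {q \<in> stone_cech. \<epsilon> \<le> q (v n)})"
  have clQn: "closed {q \<in> stone_cech. \<epsilon> \<le> q (v n)}" for n
    using closed_Int[OF cl closed_Collect_le[OF continuous_on_const coord, of \<epsilon> "v n"]] 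
    by (simp add: Collect_conj_eq)
  have "Q = stone_cech \<inter> Q" "closed Q"
    unfolding Q_def using clQn by (auto intro: closed_INT)
  then have "compact Q"
    using compact_Int_closed[OF compact_stone_cech] by metis
  moreover have "sc_embed z \<notin> Q" for z
  proof -
    have "\<forall>\<^sub>F n in sequentially. v n z < \<epsilon>"
      using order_tendstoD(2)[OF lim \<epsilon>] .
    then obtain n where "v n z < \<epsilon>"
      using eventually_happens'[OF sequentially_bot] by blast
    then have "\<not> \<epsilon> \<le> sc_embed z (v n)"
      by (simp add: sc_embed_def)
    then show ?thesis
      by (auto simp: Q_def)
  qed
  ultimately have Q: "Q \<in> remainder_compacts"
    by (auto simp: remainder_compacts_def Q_def)
  obtain h e where h: "continuous_on stone_cech h" "\<forall>q\<in>Q. h q = 0" "e > 0"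
    "\<And>g. strict_seminorm h (g - 0) < e \<Longrightarrow> g \<in> V"
    using openin_beta_Q_imp_ball[OF openin_strict_imp_beta_Q[OF V(1) Q] V(3)] by metis
  \<comment> \<open>The points where the excess of \<open>v n\<close> over \<open>\<epsilon>\<close>
    is not yet damped by the weight. A point common to all these decreasing closed sets would lie in
    \<open>Q\<close>, where \<open>h\<close> vanishes.\<close>
  define C where "C n = {q \<in> stone_cech. e / 4 \<le> \<bar>h q\<bar> * max 0 (q (v n) - \<epsilon>)}" for n
  have clC: "closed (C n)" for n
  proof -
    have "continuous_on stone_cech (\<lambda>q. \<bar>h q\<bar> * max 0 (q (v n) - \<epsilon>))"
      by (intro continuous_intros h coord)
    then have "closed (stone_cech \<inter> (\<lambda>q. \<bar>h q\<bar> * max 0 (q (v n) - \<epsilon>)) -` {e / 4..})"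
      by (rule continuous_closed_preimage[OF _ cl closed_atLeast])
    then show ?thesis
      by (simp add: C_def vimage_def Collect_conj_eq)
  qed
  have Cdec: "C m \<subseteq> C n" if "n \<le> m" for m n
    using that
  proof (induction rule: dec_induct)
    case (step k)
    have "C (Suc k) \<subseteq> C k"
    proof
      fix q assume q: "q \<in> C (Suc k)"
      have "\<bar>h q\<bar> * max 0 (q (v (Suc k)) - \<epsilon>) \<le> \<bar>h q\<bar> * max 0 (q (v k) - \<epsilon>)"
        using dec'[of q k] q by (intro mult_left_mono) (auto simp: C_def)
      then show "q \<in> C k"
        using q by (simp add: C_def)
    qed
    then show ?case
      using step.IH by blast
  qed simp
  have "\<exists>n. C n = {}"
  proof (rule ccontr)
    assume ne: "\<nexists>n. C n = {}"
    have "stone_cech \<inter> (\<Inter>n\<in>UNIV. C n) \<noteq> {}"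
    proof (rule compact_imp_fip_image[OF compact_stone_cech])
      fix I :: "nat set" assume "finite I"
      then have "C (Max (insert 0 I)) \<subseteq> C n" if "n \<in> I" for n
        using that by (intro Cdec Max_ge) auto
      moreover have "C (Max (insert 0 I)) \<subseteq> stone_cech"
        unfolding C_def by blast
      ultimately have "C (Max (insert 0 I)) \<subseteq> stone_cech \<inter> (\<Inter>n\<in>I. C n)"
        by blast
      then show "stone_cech \<inter> (\<Inter>n\<in>I. C n) \<noteq> {}"
        using ne by fastforce
    qed (rule clC)
    then obtain q where q: "q \<in> stone_cech" "\<And>n. e / 4 \<le> \<bar>h q\<bar> * max 0 (q (v n) - \<epsilon>)"
      by (auto simp: C_def)
    have "\<epsilon> \<le> q (v n)" for n
      using q(2)[of n] h(3) by (cases "\<epsilon> \<le> q (v n)") auto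
    then have "q \<in> Q"
      using q(1) by (simp add: Q_def)
    then show False
      using q(2)[of 0] h by simp
  qed
  then obtain n0 where n0: "C n0 = {}" by blast
  have "p n \<in> V" if "n \<ge> n0" for n
  proof -
    have Cn: "C n = {}"
      using Cdec[OF that] n0 by simp
    \<comment> \<open>Truncation at height \<open>\<epsilon>\<close>: \<open>c\<close> is small in
      norm, while \<open>p n - c\<close> is bounded by the excess of \<open>v n\<close> and hence
      small in the seminorm of \<open>h\<close>.\<close>
    define c where "c = Bcontfun (\<lambda>z. max (- \<epsilon>) (min \<epsilon> (p n z)))"
    have "(\<lambda>z. max (- \<epsilon>) (min \<epsilon> (p n z))) \<in> bcontfun"
      using \<epsilon> by (intro bcontfun_normI[where b = \<epsilon>]) (auto intro!: continuous_intros)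
    then have c: "c z = max (- \<epsilon>) (min \<epsilon> (p n z))" for z
      unfolding c_def by (simp add: Bcontfun_inverse)
    have "norm c \<le> \<epsilon>"
      using \<epsilon> by (intro norm_bound) (auto simp: c)
    then have 1: "2 *\<^sub>R c \<in> V"
      by (intro d) (simp add: \<epsilon>_def)
    have "strict_seminorm h (2 *\<^sub>R (p n - c)) \<le> e / 2"
    proof (rule strict_seminorm_least)
      fix z
      have "\<bar>p n z - c z\<bar> \<le> max 0 (v n z - \<epsilon>)"
        using le[of n z] \<epsilon> by (auto simp: c max_def min_def abs_if split: if_splits)
      then have "\<bar>h (sc_embed z)\<bar> * \<bar>p n z - c z\<bar> \<le> \<bar>h (sc_embed z)\<bar> * max 0 (sc_embed z (v n) - \<epsilon>)"
        by (intro mult_left_mono) (auto simp: sc_embed_def)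
      also have "\<dots> < e / 4"
        using Cn sc_embed_in_stone_cech[of z] by (auto simp: C_def)
      finally have "\<bar>h (sc_embed z)\<bar> * \<bar>p n z - c z\<bar> < e / 4" .
      moreover have "h (sc_embed z) * apply_bcontfun (2 *\<^sub>R (p n - c)) z = 2 * (h (sc_embed z) * (p n z - c z))"
        by (simp add: algebra_simps)
      ultimately show "\<bar>h (sc_embed z) * apply_bcontfun (2 *\<^sub>R (p n - c)) z\<bar> \<le> e / 2"
        by (simp only: abs_mult abs_numeral)
    qed
    then have 2: "2 *\<^sub>R (p n - c) \<in> V"
      using h(3) by (intro h(4)) simp
    have "(1 / 2) *\<^sub>R (2 *\<^sub>R c) + (1 / 2) *\<^sub>R (2 *\<^sub>R (p n - c)) \<in> V"
      by (rule convexD[OF V(2) 1 2]) simp_all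
    then show ?thesis
      by simp
  qed
  then show ?thesis
    using V(4) unfolding eventually_sequentially by blast
qed

section \<open>Charges and gliding humps\<close>

lemma sum_abs_le_subset_sums:
  fixes a :: "'i \<Rightarrow> real"
  assumes "finite F" "\<And>G. G \<subseteq> F \<Longrightarrow> \<bar>sum a G\<bar> \<le> B"
  shows "(\<Sum>i\<in>F. \<bar>a i\<bar>) \<le> 2 * B"
proof -
  let ?P = "{i \<in> F. a i \<ge> 0}" and ?N = "{i \<in> F. a i < 0}"
  have "(\<Sum>i\<in>F. \<bar>a i\<bar>) = (\<Sum>i\<in>?P. \<bar>a i\<bar>) + (\<Sum>i\<in>?N. \<bar>a i\<bar>)"
    using assms(1) by (subst sum.union_disjoint[symmetric]) (auto intro!: sum.cong)
  also have "\<dots> = sum a ?P - sum a ?N"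
    by (simp add: sum_negf[symmetric])
  also have "\<dots> \<le> 2 * B"
    using assms(2)[of ?P] assms(2)[of ?N] by auto
  finally show ?thesis .
qed

lemma abs_summable_on_of_subset_sums:
  fixes a :: "'i \<Rightarrow> real"
  assumes "\<And>G. finite G \<Longrightarrow> \<bar>sum a G\<bar> \<le> B"
  shows "(\<lambda>i. \<bar>a i\<bar>) summable_on A" "(\<Sum>\<^sub>\<infinity>i\<in>A. \<bar>a i\<bar>) \<le> 2 * B"
proof -
  have le: "(\<Sum>i\<in>F. \<bar>a i\<bar>) \<le> 2 * B" if "finite F" for F
    using that assms by (intro sum_abs_le_subset_sums) (auto intro: finite_subset)
  show "(\<lambda>i. \<bar>a i\<bar>) summable_on A"
    by (rule nonneg_bdd_above_summable_on) (use le in \<open>auto intro!: bdd_aboveI2[where M = "2 * B"]\<close>)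
  then show "(\<Sum>\<^sub>\<infinity>i\<in>A. \<bar>a i\<bar>) \<le> 2 * B"
    by (rule infsum_le_finite_sums) (use le in auto)
qed

text \<open>Branches of the binary tree: \<open>J x\<close> collects codes of the finite initial
  segments of \<open>x\<close>, and two branches share only the segments before they part. The index
  type is uncountable.\<close>

lemma almost_disjoint_family:
  obtains J :: "(nat \<Rightarrow> bool) \<Rightarrow> nat set"
  where "\<And>x. infinite (J x)" "\<And>x y. x \<noteq> y \<Longrightarrow> finite (J x \<inter> J y)"
proof
  define c where "c x n = to_nat (map x [0..<n])" for x :: "nat \<Rightarrow> bool" and n
  have c: "n = m \<and> (\<forall>i<n. x i = y i)" if "c x n = c y m" for x y n m
  proof -
    have eq: "map x [0..<n] = map y [0..<m]"
      using that by (simp add: c_def)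
    then have "n = m"
      by (metis length_map length_upt minus_nat.diff_0)
    then show ?thesis
      using eq by auto
  qed
  show "infinite (range (c x))" for x
    using c by (intro range_inj_infinite injI) blast
  show "finite (range (c x) \<inter> range (c y))" if "x \<noteq> y" for x y
  proof -
    obtain k where "x k \<noteq> y k"
      using \<open>x \<noteq> y\<close> by blast
    have "range (c x) \<inter> range (c y) \<subseteq> c x ` {..k}"
    proof
      fix q assume "q \<in> range (c x) \<inter> range (c y)"
      then obtain n m where q: "q = c x n" "c x n = c y m"
        by auto
      then have "\<not> k < n"
        using c[OF q(2)] \<open>x k \<noteq> y k\<close> by blast
      then show "q \<in> c x ` {..k}"
        using q(1) by simp
    qed
    then show ?thesis
      by (rule finite_subset) simp
  qed
qed

text \<open>A charge that ignores finite sets is additive over the almost disjoint sets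
  \<open>A x\<close>. Boundedness makes its values there absolutely summable, so only countably many
  are nonzero; countably many charges cannot exhaust the uncountable index set.\<close>

lemma bounded_charges_vanish_on_common_union:
  fixes I :: "nat \<Rightarrow> nat set" and Z :: "(nat set \<Rightarrow> real) set"
  assumes Z: "countable Z"
    and add: "\<And>s A B. s \<in> Z \<Longrightarrow> A \<inter> B = {} \<Longrightarrow> s (A \<union> B) = s A + s B"
    and bdd: "\<And>s. s \<in> Z \<Longrightarrow> \<exists>B. \<forall>A. \<bar>s A\<bar> \<le> B"
    and fin: "\<And>s A. s \<in> Z \<Longrightarrow> finite A \<Longrightarrow> s A = 0"
    and I: "\<And>i. finite (I i)" "disjoint_family I"
  obtains J where "infinite J" "\<And>s. s \<in> Z \<Longrightarrow> s (\<Union> (I ` J)) = 0"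
proof -
  obtain J :: "(nat \<Rightarrow> bool) \<Rightarrow> nat set" where J: "\<And>x. infinite (J x)"
    "\<And>x y. x \<noteq> y \<Longrightarrow> finite (J x \<inter> J y)"
    using almost_disjoint_family by blast
  define A where "A x = \<Union> (I ` J x)" for x
  have AD: "finite (A x \<inter> A y)" if "x \<noteq> y" for x y
  proof -
    have "A x \<inter> A y \<subseteq> \<Union> (I ` (J x \<inter> J y))"
    proof
      fix n assume "n \<in> A x \<inter> A y"
      then obtain i j where ij: "i \<in> J x" "j \<in> J y" "n \<in> I i" "n \<in> I j"
        by (auto simp: A_def)
      then have "i = j"
        using I(2) by (auto simp: disjoint_family_on_def)
      then show "n \<in> \<Union> (I ` (J x \<inter> J y))"
        using ij by blast
    qed
    then show ?thesis
      by (rule finite_subset) (use I(1) J(2)[OF that] in auto)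
  qed
  have add': "s (C \<union> D) = s C + s D" if "s \<in> Z" "finite (C \<inter> D)" for s C D
  proof -
    have eq: "C \<union> D = C \<union> (D - C)" "D = (D - C) \<union> (C \<inter> D)"
      by blast+
    have "s (C \<union> D) = s C + s (D - C)"
      by (subst eq(1), rule add[OF that(1)]) blast
    moreover have "s D = s (D - C) + s (C \<inter> D)"
      by (subst eq(2), rule add[OF that(1)]) blast
    ultimately show ?thesis
      using fin[OF that] by simp
  qed
  have sumA: "s (\<Union> (A ` F)) = (\<Sum>x\<in>F. s (A x))" if "s \<in> Z" "finite F" for s F
    using that(2)
  proof induction
    case empty
    then show ?case
      using fin[OF that(1)] by simp
  next
    case (insert x F)
    have "finite (\<Union> (A ` F) \<inter> A x)"
    proof -
      have "\<Union> (A ` F) \<inter> A x = (\<Union>y\<in>F. A y \<inter> A x)"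
        by blast
      moreover have "finite (A y \<inter> A x)" if "y \<in> F" for y
        using AD[of y x] that insert.hyps(2) by metis
      ultimately show ?thesis
        using insert.hyps(1) by (simp only: finite_UN_I)
    qed
    then have "s (\<Union> (A ` F) \<union> A x) = s (\<Union> (A ` F)) + s (A x)"
      by (rule add'[OF that(1)])
    moreover have "\<Union> (A ` insert x F) = \<Union> (A ` F) \<union> A x"
      by blast
    ultimately show ?case
      using insert.IH insert.hyps by simp
  qed
  have "countable {x. s (A x) \<noteq> 0}" if "s \<in> Z" for s
  proof -
    obtain B where "\<And>A. \<bar>s A\<bar> \<le> B"
      using bdd[OF \<open>s \<in> Z\<close>] by blast
    then have "\<bar>\<Sum>x\<in>F. s (A x)\<bar> \<le> B" if "finite F" for F
      using sumA[OF \<open>s \<in> Z\<close> that] by metis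
    then have "(\<lambda>x. \<bar>s (A x)\<bar>) summable_on UNIV"
      by (rule abs_summable_on_of_subset_sums)
    from summable_countable_real[OF this] show ?thesis
      by simp
  qed
  then have cb: "countable (\<Union>s\<in>Z. {x. s (A x) \<noteq> 0})" (is "countable ?bad")
    using Z by blast
  \<comment> \<open>Cantor's diagonal: \<open>x\<close> differs from the \<open>n\<close>-th
    enumerated bad index at position \<open>n\<close>.\<close>
  define x where "x n = (\<not> from_nat_into ?bad n n)" for n
  have "x \<notin> ?bad"
  proof
    assume "x \<in> ?bad"
    then obtain n where "from_nat_into ?bad n = x"
      using from_nat_into_surj[OF cb] by blast
    then show False
      by (metis x_def)
  qed
  then show thesis
    using that[OF J(1)[of x]] by (auto simp: A_def)
qed

section \<open>Tails of series and gliding humps\<close>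

lemma infsum_split_tail:
  fixes a :: "nat \<Rightarrow> real"
  assumes "a summable_on UNIV"
  shows "infsum a UNIV = sum a {..<M} + infsum a {M..}"
proof -
  have "UNIV = {..<M} \<union> {M..}"
    by auto
  moreover have "infsum a ({..<M} \<union> {M..}) = infsum a {..<M} + infsum a {M..}"
    by (rule infsum_Un_disjoint) (auto intro: summable_on_subset_banach[OF assms])
  ultimately show ?thesis
    by simp
qed

lemma infsum_nonneg_tail_small:
  fixes a :: "nat \<Rightarrow> real"
  assumes "a summable_on UNIV" "\<And>n. a n \<ge> 0" "e > 0"
  obtains M where "M \<ge> M0" "infsum a {M..} < e"
proof -
  have "(sum a \<longlongrightarrow> infsum a UNIV) (finite_subsets_at_top UNIV)"
    using assms(1) by (simp add: has_sum_def[symmetric])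
  then have "\<forall>\<^sub>F F in finite_subsets_at_top UNIV. infsum a UNIV - e < sum a F"
    using \<open>e > 0\<close> by (intro order_tendstoD) auto
  then obtain F where F: "finite F" "infsum a UNIV - e < sum a F"
    by (auto simp: eventually_finite_subsets_at_top)
  define M where "M = max M0 (Suc (Max (insert 0 F)))"
  have "F \<subseteq> {..<M}"
  proof
    fix n assume "n \<in> F"
    then have "n \<le> Max (insert 0 F)"
      using F(1) by (intro Max_ge) auto
    then show "n \<in> {..<M}"
      by (simp add: M_def)
  qed
  then have "sum a F \<le> sum a {..<M}"
    using assms(2) by (intro sum_mono2) auto
  moreover have "infsum a UNIV = sum a {..<M} + infsum a {M..}"
    using assms(1) by (rule infsum_split_tail)
  ultimately show thesis
    using F(2) by (intro that[of M]) (auto simp: M_def)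
qed

lemma infsum_abs_bound_subset:
  fixes a :: "'i \<Rightarrow> real"
  assumes "(\<lambda>n. \<bar>a n\<bar>) summable_on B" "A \<subseteq> B"
  shows "\<bar>infsum a A\<bar> \<le> (\<Sum>\<^sub>\<infinity>n\<in>B. \<bar>a n\<bar>)"
proof -
  have A: "(\<lambda>n. \<bar>a n\<bar>) summable_on A"
    using assms by (rule summable_on_subset_banach)
  have "\<bar>infsum a A\<bar> \<le> (\<Sum>\<^sub>\<infinity>n\<in>A. \<bar>a n\<bar>)"
    using norm_infsum_bound[of a A] A by simp
  also have "\<dots> \<le> (\<Sum>\<^sub>\<infinity>n\<in>B. \<bar>a n\<bar>)"
    using A assms by (intro infsum_mono2) auto
  finally show ?thesis .
qed

text \<open>A far row of large absolute sum has little mass on the columns used so far and so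
  carries most of it in a fresh finite window, where a block with signed sum of modulus at least
  \<open>3 * e\<close> is found. All other blocks lie left or right of the window, where the row has
  mass below \<open>e\<close> on each side, so no selection of them cancels the hump.\<close>

lemma l1_gliding_hump:
  fixes d :: "nat \<Rightarrow> nat \<Rightarrow> real"
  assumes sm: "\<And>j. (\<lambda>n. \<bar>d j n\<bar>) summable_on UNIV"
    and pt: "\<And>n. (\<lambda>j. d j n) \<longlonglongrightarrow> 0"
    and no: "\<not> (\<lambda>j. \<Sum>\<^sub>\<infinity>n. \<bar>d j n\<bar>) \<longlonglongrightarrow> 0"
  obtains I :: "nat \<Rightarrow> nat set" and r e where "strict_mono r" "e > 0"
    "\<And>i. finite (I i)" "disjoint_family I"
    "\<And>J i. i \<in> J \<Longrightarrow> e \<le> \<bar>infsum (d (r i)) (\<Union> (I ` J))\<bar>"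
proof -
  define S where "S j = (\<Sum>\<^sub>\<infinity>n. \<bar>d j n\<bar>)" for j
  have S0: "S j \<ge> 0" for j
    unfolding S_def by (rule infsum_nonneg) simp
  obtain e0 where e0: "e0 > 0" "\<And>N. \<exists>j\<ge>N. S j \<ge> e0"
    using no S0 unfolding lim_sequentially S_def[symmetric]
    by (metis abs_of_nonneg diff_zero dist_real_def leI)
  \<comment> \<open>Budget: \<open>8 * e\<close> less the two ends leaves over \<open>6 * e\<close>
    in the window; choosing one sign costs a factor 2, and the \<open>3 * e\<close> so obtained
    survives two errors below \<open>e\<close>.\<close>
  define e where "e = e0 / 8"
  have e: "e > 0"
    using e0 by (simp add: e_def)
  have sm': "(\<lambda>n. \<bar>d j n\<bar>) summable_on A" for j A
    by (rule summable_on_subset_banach[OF sm]) simp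
  \<comment> \<open>A state holds a row, the right end of its window and its block; the window
    begins at the right end of the preceding one.\<close>
  let ?R = "\<lambda>(j, M, I) (j', M', I'). j < j' \<and> M \<le> M' \<and> I' \<subseteq> {M..<M'} \<and> 3 * e \<le> \<bar>sum (d j') I'\<bar> \<and>
    (\<Sum>n<M. \<bar>d j' n\<bar>) < e \<and> (\<Sum>\<^sub>\<infinity>n\<in>{M'..}. \<bar>d j' n\<bar>) < e"
  have step: "\<exists>q. ?R p q" for p :: "nat \<times> nat \<times> nat set"
  proof -
    obtain j M I where p: "p = (j, M, I)"
      by (cases p)
    have "(\<lambda>j. \<Sum>n<M. \<bar>d j n\<bar>) \<longlonglongrightarrow> 0"
      using tendsto_sum[of "{..<M}" "\<lambda>n j. \<bar>d j n\<bar>" "\<lambda>n. 0" sequentially] tendsto_rabs_zero[OF pt] by simp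
    then have "\<forall>\<^sub>F j in sequentially. (\<Sum>n<M. \<bar>d j n\<bar>) < e"
      using e by (rule order_tendstoD)
    then obtain N where N: "\<And>j. j \<ge> N \<Longrightarrow> (\<Sum>n<M. \<bar>d j n\<bar>) < e"
      by (auto simp: eventually_sequentially)
    obtain j' where j': "j' \<ge> max N (Suc j)" "S j' \<ge> 8 * e"
      using e0(2)[of "max N (Suc j)"] by (auto simp: e_def)
    obtain M' where M': "M' \<ge> M" "(\<Sum>\<^sub>\<infinity>n\<in>{M'..}. \<bar>d j' n\<bar>) < e"
      using infsum_nonneg_tail_small[OF sm _ e, of j' M] by auto
    have "S j' = (\<Sum>n<M'. \<bar>d j' n\<bar>) + (\<Sum>\<^sub>\<infinity>n\<in>{M'..}. \<bar>d j' n\<bar>)"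
      unfolding S_def using sm by (rule infsum_split_tail)
    moreover have "(\<Sum>n<M'. \<bar>d j' n\<bar>) = (\<Sum>n<M. \<bar>d j' n\<bar>) + (\<Sum>n=M..<M'. \<bar>d j' n\<bar>)"
      using M'(1) by (simp add: atLeast0LessThan[symmetric] sum.atLeastLessThan_concat)
    ultimately have big: "(\<Sum>n=M..<M'. \<bar>d j' n\<bar>) > 2 * (3 * e)"
      using j' M'(2) N[of j'] by simp
    have "\<exists>I'\<subseteq>{M..<M'}. 3 * e \<le> \<bar>sum (d j') I'\<bar>"
    proof (rule ccontr)
      assume "\<not> ?thesis"
      then have "(\<Sum>n=M..<M'. \<bar>d j' n\<bar>) \<le> 2 * (3 * e)"
        by (intro sum_abs_le_subset_sums) (auto simp: not_le intro: less_imp_le)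
      then show False
        using big by simp
    qed
    then obtain I' where "I' \<subseteq> {M..<M'}" "3 * e \<le> \<bar>sum (d j') I'\<bar>"
      by blast
    then have "?R p (j', M', I')"
      using j'(1) M' N[of j'] by (simp add: p)
    then show ?thesis
      by blast
  qed
  have "\<forall>p :: nat \<times> nat \<times> nat set. \<exists>q. ?R p q"
    by (intro allI step)
  from choice[OF this] obtain next_step where next_step: "\<forall>p :: nat \<times> nat \<times> nat set. ?R p (next_step p)"
    by (elim exE) (rule that)
  define p where "p = rec_nat (0, 0, {}) (\<lambda>_. next_step)"
  have p: "?R (p i) (p (Suc i))" for i
    using spec[OF next_step, of "p i"] by (simp add: p_def)
  \<comment> \<open>Row and block are read off after the step, the left end \<open>M i\<close>
    before it; this skips the empty block of the initial state.\<close>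
  define r where "r i = fst (p (Suc i))" for i
  define M where "M i = fst (snd (p i))" for i
  define I where "I i = snd (snd (p (Suc i)))" for i
  have pS: "r i < r (Suc i)" "M i \<le> M (Suc i)" "I i \<subseteq> {M i..<M (Suc i)}" "3 * e \<le> \<bar>sum (d (r i)) (I i)\<bar>"
    "(\<Sum>n<M i. \<bar>d (r i) n\<bar>) < e" "(\<Sum>\<^sub>\<infinity>n\<in>{M (Suc i)..}. \<bar>d (r i) n\<bar>) < e" for i
    using p[of i] p[of "Suc i"] by (auto simp: r_def M_def I_def case_prod_unfold)
  have "mono M"
    by (simp add: incseq_Suc_iff[symmetric] incseq_SucI pS(2))
  then have M: "M i \<le> M j" if "i \<le> j" for i j
    using that by (simp add: monoD)
  have finI: "finite (I i)" for i
    using pS(3) by (rule finite_subset) simp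
  have outside: "I k \<subseteq> {..<M i} \<union> {M (Suc i)..}" if "k \<noteq> i" for i k
  proof (cases "k < i")
    case True
    then show ?thesis
      using pS(3)[of k] M[of "Suc k" i] by fastforce
  next
    case False
    then show ?thesis
      using that pS(3)[of k] M[of "Suc i" k] by fastforce
  qed
  have disj: "I i \<inter> I k = {}" if "k \<noteq> i" for i k
    using outside[OF that] pS(3)[of i] by fastforce
  show thesis
  proof
    show "strict_mono r"
      by (simp add: strict_mono_Suc_iff pS(1))
    show "disjoint_family I"
      using disj by (auto simp: disjoint_family_on_def)
    fix J :: "nat set" and i assume i: "i \<in> J"
    let ?A = "\<Union> (I ` J)" and ?d = "d (r i)"
    have sd: "?d summable_on B" for B
      by (rule abs_summable_summable) (simp add: sm')
    have "I k \<subseteq> I i \<union> ({..<M i} \<union> {M (Suc i)..})" for k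
      using outside[of k i] by (cases "k = i") auto
    then have eq: "?A = I i \<union> (?A \<inter> {..<M i} \<union> ?A \<inter> {M (Suc i)..})"
      using i by (simp only: Int_Un_distrib[symmetric]) blast
    have d1: "I i \<inter> (?A \<inter> {..<M i} \<union> ?A \<inter> {M (Suc i)..}) = {}"
      using pS(3)[of i] by auto
    have d2: "(?A \<inter> {..<M i}) \<inter> (?A \<inter> {M (Suc i)..}) = {}"
      using pS(2)[of i] by auto
    have "infsum ?d ?A = infsum ?d (I i) + (infsum ?d (?A \<inter> {..<M i}) + infsum ?d (?A \<inter> {M (Suc i)..}))"
      by (subst eq) (simp only: infsum_Un_disjoint[OF sd sd d1] infsum_Un_disjoint[OF sd sd d2])
    moreover have "\<bar>infsum ?d (?A \<inter> {..<M i})\<bar> < e"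
      using infsum_abs_bound_subset[OF sm', of "?A \<inter> {..<M i}" "{..<M i}" "r i"] pS(5)[of i] by simp
    moreover have "\<bar>infsum ?d (?A \<inter> {M (Suc i)..})\<bar> < e"
      using infsum_abs_bound_subset[OF sm', of "?A \<inter> {M (Suc i)..}" "{M (Suc i)..}" "r i"] pS(6)[of i] by simp
    ultimately show "e \<le> \<bar>infsum ?d ?A\<bar>"
      using pS(4)[of i] finI[of i] by simp
  qed (rule e finI)+
qed

section \<open>Bounded charges with values in bounded continuous functions\<close>

lemma additive_finite_sum:
  fixes \<Psi> :: "'i set \<Rightarrow> 'v::real_vector"
  assumes add: "\<And>A B. A \<inter> B = {} \<Longrightarrow> \<Psi> (A \<union> B) = \<Psi> A + \<Psi> B" and "finite A"
  shows "\<Psi> A = (\<Sum>i\<in>A. \<Psi> {i})"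
  using assms(2)
proof induction
  case empty
  then show ?case
    using add[of "{}" "{}"] by simp
next
  case (insert i A)
  then show ?case
    using add[of "{i}" A] by simp
qed

lemma apply_bcontfun_sum: "apply_bcontfun (sum f A) x = (\<Sum>i\<in>A. apply_bcontfun (f i) x)"
  by (induction A rule: infinite_finite_induct) simp_all

lemma infsum_diff_real:
  fixes f g :: "'i \<Rightarrow> real"
  assumes "f summable_on A" "g summable_on A"
  shows "(\<Sum>\<^sub>\<infinity>i\<in>A. f i - g i) = infsum f A - infsum g A"
  using infsum_add[of f A "\<lambda>i. - g i"] assms by (simp add: infsum_uminus summable_on_uminus)

text \<open>Used twice: for sums of differences of a sequence in the domain, and for the images of
  these sums under \<open>T\<close>.\<close>

locale bounded_bcontfun_charge =
  fixes \<Psi> :: "nat set \<Rightarrow> 'y::metric_space \<Rightarrow>\<^sub>C real" and K :: real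
  assumes additive: "\<And>A B. A \<inter> B = {} \<Longrightarrow> \<Psi> (A \<union> B) = \<Psi> A + \<Psi> B"
    and bound: "\<And>A. norm (\<Psi> A) \<le> K"
begin

definition u :: "nat \<Rightarrow> 'y \<Rightarrow> real" where
  "u n = apply_bcontfun (\<Psi> {n})"

lemma finite_sum: "finite A \<Longrightarrow> \<Psi> A y = (\<Sum>n\<in>A. u n y)"
  using additive_finite_sum[OF additive, of A] unfolding u_def
  by (simp add: apply_bcontfun_sum)

lemma apply_le: "\<bar>\<Psi> A y\<bar> \<le> K"
  using norm_bounded[of "\<Psi> A" y] bound[of A] by simp

text \<open>Sums over finite sets are values of \<open>\<Psi>\<close>, hence bounded by
  \<open>K\<close> uniformly in the point; splitting by sign doubles the bound.\<close>

lemma abs_summable: "(\<lambda>n. \<bar>u n y\<bar>) summable_on A"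
  and abs_infsum_le: "(\<Sum>\<^sub>\<infinity>n\<in>A. \<bar>u n y\<bar>) \<le> 2 * K"
proof -
  have "\<bar>\<Sum>n\<in>F. u n y\<bar> \<le> K" if "finite F" for F
    using apply_le[of F y] finite_sum[OF that] by simp
  from abs_summable_on_of_subset_sums[OF this]
  show "(\<lambda>n. \<bar>u n y\<bar>) summable_on A" "(\<Sum>\<^sub>\<infinity>n\<in>A. \<bar>u n y\<bar>) \<le> 2 * K"
    by blast+
qed

lemma summable: "(\<lambda>n. u n y) summable_on A"
  by (rule abs_summable_summable) (simp add: abs_summable)

text \<open>What is left of the charge at \<open>y\<close> once its countably additive part is
  removed; it vanishes on finite sets.\<close>

definition singular_part :: "'y \<Rightarrow> nat set \<Rightarrow> real" where
  "singular_part y A = \<Psi> A y - (\<Sum>\<^sub>\<infinity>n\<in>A. u n y)"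

lemma diff_abs_summable: "(\<lambda>n. \<bar>u n y - u n z\<bar>) summable_on A"
proof (rule summable_on_comparison_test)
  show "(\<lambda>n. \<bar>u n y\<bar> + \<bar>u n z\<bar>) summable_on A"
    by (intro summable_on_add abs_summable)
qed auto

text \<open>
  If this failed, a gliding hump would make the countably additive part of \<open>\<Psi>\<close> discontinuous along the
  sequence on every union of the blocks. Among uncountably many almost disjoint unions there is
  one on which the singular parts at the countably many points involved vanish, so that
  \<open>\<Psi>\<close> itself would be discontinuous.
\<close>

lemma l1_continuous:
  assumes lim: "y \<longlonglongrightarrow> l"
  shows "(\<lambda>j. \<Sum>\<^sub>\<infinity>n. \<bar>u n (y j) - u n l\<bar>) \<longlonglongrightarrow> 0"
proof (rule ccontr)
  have contl: "(\<lambda>j. \<Psi> A (y j)) \<longlonglongrightarrow> \<Psi> A l" for A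
    using continuous_on_tendsto_compose[OF continuous_on_apply_bcontfun[of UNIV "\<Psi> A"] lim] by simp
  assume no: "\<not> ?thesis"
  have pt: "(\<lambda>j. u n (y j) - u n l) \<longlonglongrightarrow> 0" for n
    using contl[of "{n}"] unfolding u_def by (rule LIM_zero)
  obtain I :: "nat \<Rightarrow> nat set" and r e where r: "strict_mono r" and e: "e > 0"
    and I: "\<And>i. finite (I i)" "disjoint_family I"
    and hump: "\<And>J i. i \<in> J \<Longrightarrow> e \<le> \<bar>\<Sum>\<^sub>\<infinity>n\<in>\<Union> (I ` J). u n (y (r i)) - u n l\<bar>"
    by (rule l1_gliding_hump[OF diff_abs_summable pt no]) (rule that)
  let ?Z = "singular_part ` insert l (range y)"
  obtain J where J: "infinite J" "\<And>s. s \<in> ?Z \<Longrightarrow> s (\<Union> (I ` J)) = 0"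
  proof (rule bounded_charges_vanish_on_common_union[of ?Z I])
    show "countable ?Z"
      by simp
    show "s (A \<union> B) = s A + s B" if s: "s \<in> ?Z" and AB: "A \<inter> B = {}" for s A B
    proof -
      obtain z where "s = singular_part z"
        using s by blast
      then show ?thesis
        using additive[OF AB] infsum_Un_disjoint[OF summable summable AB, of z] by (simp add: singular_part_def)
    qed
    show "\<exists>B. \<forall>A. \<bar>s A\<bar> \<le> B" if s: "s \<in> ?Z" for s
    proof -
      obtain z where z: "s = singular_part z"
        using s by blast
      have "\<bar>s A\<bar> \<le> K + 2 * K" for A
        using apply_le[of A z] infsum_abs_bound_subset[OF abs_summable order_refl, of z A] abs_infsum_le[of z A]
        by (simp add: z singular_part_def)
      then show ?thesis
        by blast
    qed
    show "s A = 0" if s: "s \<in> ?Z" and A: "finite A" for s A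
      using s finite_sum[OF A] A by (auto simp: singular_part_def)
  qed (use I in auto)
  let ?A = "\<Union> (I ` J)"
  have "(\<Sum>\<^sub>\<infinity>n\<in>?A. u n (y j) - u n l) = \<Psi> ?A (y j) - \<Psi> ?A l" for j
    using J(2)[of "singular_part (y j)"] J(2)[of "singular_part l"]
      infsum_diff_real[OF summable summable, of "y j" l ?A] by (simp add: singular_part_def)
  then have "(\<lambda>j. \<Sum>\<^sub>\<infinity>n\<in>?A. u n (y j) - u n l) \<longlonglongrightarrow> 0"
    using LIM_zero[OF contl[of ?A]] by simp
  then have "\<forall>\<^sub>F j in sequentially. \<bar>\<Sum>\<^sub>\<infinity>n\<in>?A. u n (y j) - u n l\<bar> < e"
    by (rule order_tendstoD(2)[OF tendsto_rabs_zero e])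
  then obtain N where N: "\<And>j. j \<ge> N \<Longrightarrow> \<bar>\<Sum>\<^sub>\<infinity>n\<in>?A. u n (y j) - u n l\<bar> < e"
    by (auto simp: eventually_sequentially)
  \<comment> \<open>As \<open>J\<close> is infinite and \<open>r i \<ge> i\<close>, some hump sits
    in a row beyond \<open>N\<close>.\<close>
  obtain i where "i \<in> J" "i \<ge> N"
    using J(1) unfolding infinite_nat_iff_unbounded_le by blast
  then show False
    using N[of "r i"] hump[of i J] seq_suble[OF r, of i] by simp
qed

text \<open>Both sums change by at most the l1 distance between the sequences
  \<open>u n (y j)\<close> and \<open>u n l\<close>, which \<open>l1_continuous\<close> sends to
  zero. In a metric space sequential continuity is enough.\<close>

lemma tail_bcontfun: "(\<lambda>y. \<Sum>\<^sub>\<infinity>n\<in>A. u n y) \<in> bcontfun"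
  and abs_tail_bcontfun: "(\<lambda>y. \<Sum>\<^sub>\<infinity>n\<in>A. \<bar>u n y\<bar>) \<in> bcontfun"
proof -
  have "(\<lambda>j. \<Sum>\<^sub>\<infinity>n\<in>A. u n (y j)) \<longlonglongrightarrow> (\<Sum>\<^sub>\<infinity>n\<in>A. u n l)"
    "(\<lambda>j. \<Sum>\<^sub>\<infinity>n\<in>A. \<bar>u n (y j)\<bar>) \<longlonglongrightarrow> (\<Sum>\<^sub>\<infinity>n\<in>A. \<bar>u n l\<bar>)" if lim: "y \<longlonglongrightarrow> l" for y l
  proof -
    have "\<bar>(\<Sum>\<^sub>\<infinity>n\<in>A. u n (y j)) - (\<Sum>\<^sub>\<infinity>n\<in>A. u n l)\<bar> \<le> (\<Sum>\<^sub>\<infinity>n. \<bar>u n (y j) - u n l\<bar>)" for j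
      using infsum_diff_real[OF summable summable, of "y j" l A]
        infsum_abs_bound_subset[OF diff_abs_summable, of A UNIV "y j" l] by simp
    then show "(\<lambda>j. \<Sum>\<^sub>\<infinity>n\<in>A. u n (y j)) \<longlonglongrightarrow> (\<Sum>\<^sub>\<infinity>n\<in>A. u n l)"
      by (intro LIM_zero_cancel[OF Lim_null_comparison[OF _ l1_continuous[OF lim]]] always_eventually) simp
    have "\<bar>(\<Sum>\<^sub>\<infinity>n\<in>A. \<bar>u n (y j)\<bar>) - (\<Sum>\<^sub>\<infinity>n\<in>A. \<bar>u n l\<bar>)\<bar> \<le> (\<Sum>\<^sub>\<infinity>n. \<bar>u n (y j) - u n l\<bar>)" for j
    proof -
      have s: "(\<lambda>n. \<bar>\<bar>u n (y j)\<bar> - \<bar>u n l\<bar>\<bar>) summable_on B" for B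
        by (rule summable_on_comparison_test[OF diff_abs_summable[where y = "y j" and z = l]]) auto
      have "(\<Sum>\<^sub>\<infinity>n\<in>A. \<bar>u n (y j)\<bar>) - (\<Sum>\<^sub>\<infinity>n\<in>A. \<bar>u n l\<bar>) = (\<Sum>\<^sub>\<infinity>n\<in>A. \<bar>u n (y j)\<bar> - \<bar>u n l\<bar>)"
        by (rule infsum_diff_real[OF abs_summable abs_summable, symmetric])
      also have "\<bar>\<dots>\<bar> \<le> (\<Sum>\<^sub>\<infinity>n. \<bar>\<bar>u n (y j)\<bar> - \<bar>u n l\<bar>\<bar>)"
        by (rule infsum_abs_bound_subset[OF s]) simp
      also have "\<dots> \<le> (\<Sum>\<^sub>\<infinity>n. \<bar>u n (y j) - u n l\<bar>)"
        by (rule infsum_mono[OF s diff_abs_summable]) simp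
      finally show ?thesis .
    qed
    then show "(\<lambda>j. \<Sum>\<^sub>\<infinity>n\<in>A. \<bar>u n (y j)\<bar>) \<longlonglongrightarrow> (\<Sum>\<^sub>\<infinity>n\<in>A. \<bar>u n l\<bar>)"
      by (intro LIM_zero_cancel[OF Lim_null_comparison[OF _ l1_continuous[OF lim]]] always_eventually) simp
  qed
  then have "continuous_on UNIV (\<lambda>y. \<Sum>\<^sub>\<infinity>n\<in>A. u n y)" "continuous_on UNIV (\<lambda>y. \<Sum>\<^sub>\<infinity>n\<in>A. \<bar>u n y\<bar>)"
    by (auto simp: continuous_on_sequentially o_def)
  moreover have "\<bar>\<Sum>\<^sub>\<infinity>n\<in>A. \<bar>u n y\<bar>\<bar> \<le> 2 * K" "\<bar>\<Sum>\<^sub>\<infinity>n\<in>A. u n y\<bar> \<le> 2 * K" for y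
    using abs_infsum_le[of y A] infsum_abs_bound_subset[OF abs_summable order_refl, of y A]
      infsum_nonneg[of A "\<lambda>n. \<bar>u n y\<bar>"] by auto
  ultimately show "(\<lambda>y. \<Sum>\<^sub>\<infinity>n\<in>A. u n y) \<in> bcontfun" "(\<lambda>y. \<Sum>\<^sub>\<infinity>n\<in>A. \<bar>u n y\<bar>) \<in> bcontfun"
    by (auto intro!: bcontfun_normI[where b = "2 * K"])
qed

definition tail :: "nat \<Rightarrow> 'y \<Rightarrow>\<^sub>C real" where
  "tail N = Bcontfun (\<lambda>y. \<Sum>\<^sub>\<infinity>n\<in>{N..}. u n y)"

lemma tail_apply: "tail N y = (\<Sum>\<^sub>\<infinity>n\<in>{N..}. u n y)"
  unfolding tail_def by (simp add: Bcontfun_inverse tail_bcontfun)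

lemma tail_split: "tail 0 = \<Psi> {..<N} + tail N"
proof (rule bcontfun_eqI)
  fix y
  have "{0::nat..} = UNIV"
    by auto
  then show "tail 0 y = (\<Psi> {..<N} + tail N) y"
    using infsum_split_tail[OF summable, of y N] by (simp add: tail_apply finite_sum)
qed

text \<open>\<open>strict_Dini\<close> applies with the tails of the absolute series as majorant;
  their continuity is \<open>abs_tail_bcontfun\<close>, which rests on the gliding hump.\<close>

lemma tail_strict_tendsto_0: "limitin strict_topology tail 0 sequentially"
  unfolding limitin_def
proof (intro conjI allI impI)
  show "0 \<in> topspace strict_topology"
    by (simp add: topspace_strict)
  fix U :: "('y \<Rightarrow>\<^sub>C real) set"
  assume U: "openin strict_topology U \<and> 0 \<in> U"
  show "\<forall>\<^sub>F N in sequentially. tail N \<in> U"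
  proof (rule strict_Dini[OF _ _ _ conjunct1[OF U] conjunct2[OF U]])
    define v where "v N = Bcontfun (\<lambda>y. \<Sum>\<^sub>\<infinity>n\<in>{N..}. \<bar>u n y\<bar>)" for N
    have v: "v N y = (\<Sum>\<^sub>\<infinity>n\<in>{N..}. \<bar>u n y\<bar>)" for N y
      unfolding v_def by (simp add: Bcontfun_inverse abs_tail_bcontfun)
    have vmono: "v M y \<le> v N y" if "N \<le> M" for M N y
      unfolding v using that by (intro infsum_mono2 abs_summable) auto
    then show "v (Suc N) y \<le> v N y" for N y
      by simp
    show "(\<lambda>N. v N y) \<longlonglongrightarrow> 0" for y
    proof (rule LIMSEQ_I)
      fix e :: real assume "e > 0"
      then obtain M where "v M y < e"
        using infsum_nonneg_tail_small[OF abs_summable, of y e] unfolding v by auto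
      then have "norm (v N y - 0) < e" if "N \<ge> M" for N
        using vmono[OF that, of y] infsum_nonneg[of "{N..}" "\<lambda>n. \<bar>u n y\<bar>"] by (simp add: v)
      then show "\<exists>M. \<forall>N\<ge>M. norm (v N y - 0) < e"
        by blast
    qed
    show "\<bar>tail N y\<bar> \<le> v N y" for N y
      unfolding v tail_apply by (rule infsum_abs_bound_subset[OF abs_summable]) simp
  qed
qed

end

section \<open>Strictly closed linear maps\<close>

instance bcontfun :: (metric_space, banach) banach ..

lemma limitin_strict_iff_diff:
  fixes f :: "'i \<Rightarrow> 'a::topological_space \<Rightarrow>\<^sub>C real"
  shows "limitin strict_topology f l F \<longleftrightarrow> limitin strict_topology (\<lambda>n. f n - l) 0 F"
proof -
  have shift: "limitin strict_topology (\<lambda>n. a + f n) (a + l) F" if "limitin strict_topology f l F"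
    for a l and f :: "'i \<Rightarrow> 'a \<Rightarrow>\<^sub>C real"
    unfolding limitin_def
  proof (intro conjI allI impI)
    fix U :: "('a \<Rightarrow>\<^sub>C real) set"
    assume "openin strict_topology U \<and> a + l \<in> U"
    then have "openin strict_topology ((\<lambda>y. a + y) -` U)" "l \<in> (\<lambda>y. a + y) -` U"
      using openin_locally_convex_translation[OF locally_convex_strict] by auto
    then show "\<forall>\<^sub>F n in F. a + f n \<in> U"
      using that unfolding limitin_def by fastforce
  qed (simp add: topspace_strict)
  show ?thesis
    using shift[of f l "- l"] shift[of "\<lambda>n. f n - l" 0 l] by auto
qed

lemma tendsto_imp_limitin_strict:
  fixes f :: "'i \<Rightarrow> 'a::topological_space \<Rightarrow>\<^sub>C real"
  assumes "(f \<longlongrightarrow> l) F"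
  shows "limitin strict_topology f l F"
  unfolding limitin_strict_iff_diff[of f]
  unfolding limitin_def
proof (intro conjI allI impI)
  fix U :: "('a \<Rightarrow>\<^sub>C real) set"
  assume U: "openin strict_topology U \<and> 0 \<in> U"
  obtain d where d: "d > 0" "\<And>f. norm f \<le> d \<Longrightarrow> f \<in> U"
    using strict_nhd_norm[OF conjunct1[OF U] conjunct2[OF U]] by metis
  show "\<forall>\<^sub>F n in F. f n - l \<in> U"
    using tendstoD[OF assms d(1)] by eventually_elim (simp add: d(2) dist_norm)
qed (simp add: topspace_strict)

locale closed_strict_map =
  fixes T :: "('x::metric_space \<Rightarrow>\<^sub>C real) \<Rightarrow> 'y::metric_space \<Rightarrow>\<^sub>C real"
  assumes linear: "linear T"
    and closed_graph:
      "closedin (prod_topology strict_topology strict_topology) (range (\<lambda>f. (f, T f)))"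
begin

lemma closed_graphD:
  assumes "limitin strict_topology f l sequentially"
    and "limitin strict_topology (\<lambda>n. T (f n)) m sequentially"
  shows "T l = m"
proof -
  have "limitin (prod_topology strict_topology strict_topology) (\<lambda>n. (f n, T (f n))) (l, m) sequentially"
    using assms by (simp add: limitin_pairwise o_def)
  then have "(l, m) \<in> range (\<lambda>f. (f, T f))"
    by (rule limitin_closedin[OF _ closed_graph]) auto
  then show ?thesis
    by blast
qed

text \<open>Norm convergence implies strict convergence, so the graph is also closed under norm
  limits and the Banach space theorem applies.\<close>

lemma norm_bound:
  obtains K where "K \<ge> 0" "\<And>f. norm (T f) \<le> K * norm f"
proof (rule closed_graph_bounded[OF linear])
  show "T l = m" if "x \<longlonglongrightarrow> l" "(\<lambda>n. T (x n)) \<longlonglongrightarrow> m" for x l m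
    using that by (intro closed_graphD[of x] tendsto_imp_limitin_strict)
qed (rule that)

text \<open>The differences of \<open>f\<close> define a charge whose tails are the
  \<open>f N\<close>, and \<open>T\<close> carries it to another bounded charge. Both families of
  tails tend strictly to zero, so \<open>T (f N)\<close> has a strict limit, which the closed graph
  shows to be \<open>T 0\<close>.\<close>

lemma strict_null:
  fixes f :: "nat \<Rightarrow> 'x \<Rightarrow>\<^sub>C real"
  assumes var: "\<And>N x. (\<Sum>n<N. \<bar>f n x - f (Suc n) x\<bar>) \<le> C"
    and loc: "\<And>x. \<exists>W N. open W \<and> x \<in> W \<and> (\<forall>n\<ge>N. \<forall>z\<in>W. f n z = 0)"
  shows "limitin strict_topology (\<lambda>n. T (f n)) 0 sequentially"
proof -
  define g where "g n x = f n x - f (Suc n) x" for n x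
  have gsum: "\<bar>\<Sum>n\<in>F. g n x\<bar> \<le> C" if F: "finite F" for F x
  proof -
    have "F \<subseteq> {..<Suc (Max (insert 0 F))}"
      using F Max_ge[of "insert 0 F"] by (meson finite.insertI insertCI le_imp_less_Suc lessThan_iff subsetI)
    then have "(\<Sum>n\<in>F. \<bar>g n x\<bar>) \<le> (\<Sum>n<Suc (Max (insert 0 F)). \<bar>g n x\<bar>)"
      by (intro sum_mono2) auto
    also have "\<dots> \<le> C"
      unfolding g_def by (rule var)
    finally show ?thesis
      using sum_abs[of "\<lambda>n. g n x" F] by linarith
  qed
  note gabs = abs_summable_on_of_subset_sums[OF gsum]
  have abs_infsum_le: "\<bar>\<Sum>\<^sub>\<infinity>n\<in>A. g n x\<bar> \<le> 2 * C" for A x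
    by (rule order_trans[OF infsum_abs_bound_subset[OF gabs(1) order_refl] gabs(2)])
  have gsummable: "(\<lambda>n. g n x) summable_on A" for x A
    by (rule abs_summable_summable) (simp add: gabs)
  have local_sum: "\<exists>W N. open W \<and> x \<in> W \<and> (\<forall>n\<ge>N. \<forall>z\<in>W. f n z = 0) \<and>
      (\<forall>A. \<forall>z\<in>W. (\<Sum>\<^sub>\<infinity>n\<in>A. g n z) = (\<Sum>n\<in>A \<inter> {..<N}. g n z))" for x
  proof -
    obtain W N where W: "open W" "x \<in> W" "\<And>n z. n \<ge> N \<Longrightarrow> z \<in> W \<Longrightarrow> f n z = 0"
      using loc[of x] by blast
    have "(\<Sum>\<^sub>\<infinity>n\<in>A. g n z) = (\<Sum>n\<in>A \<inter> {..<N}. g n z)" if "z \<in> W" for A z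
    proof -
      \<comment> \<open>On \<open>W\<close> all \<open>g n\<close> with \<open>n \<ge> N\<close>
        vanish together with \<open>f n\<close> and \<open>f (Suc n)\<close>.\<close>
      have "(\<Sum>\<^sub>\<infinity>n\<in>A. g n z) = (\<Sum>\<^sub>\<infinity>n\<in>A \<inter> {..<N}. g n z)"
        by (rule infsum_cong_neutral) (use W(3) that in \<open>auto simp: g_def\<close>)
      then show ?thesis
        by simp
    qed
    then show ?thesis
      using W by blast
  qed
  have Gb: "(\<lambda>x. \<Sum>\<^sub>\<infinity>n\<in>A. g n x) \<in> bcontfun" for A
  proof (rule bcontfun_normI[where b = "2 * C"])
    show "continuous_on UNIV (\<lambda>x. \<Sum>\<^sub>\<infinity>n\<in>A. g n x)"
      unfolding continuous_on_eq_continuous_at[OF open_UNIV]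
    proof
      fix x
      obtain W N where W: "open W" "x \<in> W" "\<And>z. z \<in> W \<Longrightarrow> (\<Sum>\<^sub>\<infinity>n\<in>A. g n z) = (\<Sum>n\<in>A \<inter> {..<N}. g n z)"
        using local_sum[of x] by blast
      have "continuous_on UNIV (\<lambda>z. \<Sum>n\<in>A \<inter> {..<N}. g n z)"
        unfolding g_def by (intro continuous_intros continuous_on_apply_bcontfun)
      then have "isCont (\<lambda>z. \<Sum>n\<in>A \<inter> {..<N}. g n z) x"
        by (simp add: continuous_on_eq_continuous_at)
      moreover have "\<forall>\<^sub>F z in nhds x. (\<Sum>\<^sub>\<infinity>n\<in>A. g n z) = (\<Sum>n\<in>A \<inter> {..<N}. g n z)"
        using eventually_nhds_in_open[OF W(1,2)] by (rule eventually_mono) (rule W(3))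
      ultimately show "isCont (\<lambda>x. \<Sum>\<^sub>\<infinity>n\<in>A. g n x) x"
        by (simp only: isCont_cong)
    qed
    show "norm (\<Sum>\<^sub>\<infinity>n\<in>A. g n x) \<le> 2 * C" for x
      by (simp add: abs_infsum_le)
  qed
  define G where "G A = Bcontfun (\<lambda>x. \<Sum>\<^sub>\<infinity>n\<in>A. g n x)" for A
  have G: "G A x = (\<Sum>\<^sub>\<infinity>n\<in>A. g n x)" for A x
    unfolding G_def by (simp add: Bcontfun_inverse Gb)
  interpret G: bounded_bcontfun_charge G "2 * C"
  proof
    show "G (A \<union> B) = G A + G B" if "A \<inter> B = {}" for A B
      using infsum_Un_disjoint[OF gsummable gsummable that] by (intro bcontfun_eqI) (simp add: G)
    show "norm (G A) \<le> 2 * C" for A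
      by (intro Bounded_Continuous_Function.norm_bound) (simp add: G abs_infsum_le)
  qed
  have Gtail: "G.tail N = f N" for N
  proof (rule bcontfun_eqI)
    fix x
    obtain M where M: "\<And>n. n \<ge> M \<Longrightarrow> f n x = 0"
      using loc[of x] by blast
    have "G.tail N x = (\<Sum>\<^sub>\<infinity>n\<in>{N..}. g n x)"
      by (simp add: G.tail_apply G.u_def G)
    also have "\<dots> = (\<Sum>\<^sub>\<infinity>n\<in>{N..<max N M}. g n x)"
      by (rule infsum_cong_neutral) (use M in \<open>auto simp: g_def\<close>)
    also have "\<dots> = f N x - f (max N M) x"
      using sum_Suc_diff'[of N "max N M" "\<lambda>n. - f n x"] by (simp add: g_def)
    finally show "G.tail N x = f N x"
      by (simp add: M)
  qed
  obtain K where K: "K \<ge> 0" "\<And>f. norm (T f) \<le> K * norm f"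
    using norm_bound by blast
  interpret TG: bounded_bcontfun_charge "\<lambda>A. T (G A)" "K * (2 * C)"
  proof
    show "T (G (A \<union> B)) = T (G A) + T (G B)" if "A \<inter> B = {}" for A B
      using G.additive[OF that] by (simp add: linear_add[OF linear])
    show "norm (T (G A)) \<le> K * (2 * C)" for A
      using K(2)[of "G A"] mult_left_mono[OF G.bound K(1), of A] by linarith
  qed
  \<comment> \<open>\<open>T (f N)\<close> and the tail from \<open>N\<close> arise by removing
    \<open>T (G {..<N})\<close> from \<open>T (f 0)\<close> and from the full series, so their
    difference is independent of \<open>N\<close>.\<close>
  define m where "m = T (f 0) - TG.tail 0"
  have Tf: "T (f N) = m + TG.tail N" for N
  proof -
    have "f 0 = G {..<N} + f N"
      using G.tail_split[of N] by (simp add: Gtail)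
    then have "T (f 0) = T (G {..<N}) + T (f N)"
      by (simp add: linear_add[OF linear])
    then show ?thesis
      using TG.tail_split[of N] by (simp add: m_def)
  qed
  have lim: "limitin strict_topology (\<lambda>N. T (f N)) m sequentially"
    unfolding limitin_strict_iff_diff[of _ m] using TG.tail_strict_tendsto_0 by (simp add: Tf)
  moreover have "limitin strict_topology f 0 sequentially"
    using G.tail_strict_tendsto_0 by (simp add: Gtail[abs_def])
  ultimately have "T 0 = m"
    by (intro closed_graphD)
  then show ?thesis
    using lim linear_0[OF linear] by simp
qed

end

section \<open>Truncation near the remainder\<close>

lemma geometric_series_of_unit_functions:
  fixes \<phi> :: "nat \<Rightarrow> 'a::topological_space \<Rightarrow> real"
  assumes cont: "\<And>n. continuous_on S (\<phi> n)"
    and unit: "\<And>n x. 0 \<le> \<phi> n x \<and> \<phi> n x \<le> 1"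
  shows "continuous_on S (\<lambda>x. \<Sum>n. (1 / 2) ^ n * \<phi> n x)"
    and "(1 / 2) ^ n * \<phi> n x \<le> (\<Sum>n. (1 / 2) ^ n * \<phi> n x)"
proof -
  have le: "norm ((1 / 2) ^ n * \<phi> n x) \<le> (1 / 2) ^ n" for n x
    using unit[of n x] by (simp add: mult_left_le)
  have sum: "summable (\<lambda>n. (1 / 2 :: real) ^ n)"
    by (rule summable_geometric) simp
  show "continuous_on S (\<lambda>x. \<Sum>n. (1 / 2) ^ n * \<phi> n x)"
  proof (rule uniform_limit_theorem)
    show "uniform_limit S (\<lambda>n x. \<Sum>i<n. (1 / 2) ^ i * \<phi> i x) (\<lambda>x. \<Sum>n. (1 / 2) ^ n * \<phi> n x) sequentially"
      by (rule Weierstrass_m_test[OF le sum])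
    show "\<forall>\<^sub>F n in sequentially. continuous_on S (\<lambda>x. \<Sum>i<n. (1 / 2) ^ i * \<phi> i x)"
      by (intro always_eventually allI continuous_intros cont)
  qed simp
  have "summable (\<lambda>n. (1 / 2) ^ n * \<phi> n x)"
    by (rule summable_comparison_test[OF _ sum]) (use le in blast)
  then have "sum (\<lambda>n. (1 / 2) ^ n * \<phi> n x) {n} \<le> (\<Sum>n. (1 / 2) ^ n * \<phi> n x)"
    by (rule sum_le_suminf) (use unit in auto)
  then show "(1 / 2) ^ n * \<phi> n x \<le> (\<Sum>n. (1 / 2) ^ n * \<phi> n x)"
    by simp
qed

lemma continuous_on_coordinate: "continuous_on S (\<lambda>q :: 'i \<Rightarrow> 'a::topological_space. q i)"
  by (rule continuous_on_product_then_coordinatewise) (rule continuous_on_id)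

text \<open>Compactness reduces the separation to finitely many coordinates: the sum
  \<open>s\<close> of the deviations from the coordinates of \<open>z\<close> has a positive minimum
  on a nonempty \<open>Q\<close> and vanishes at the point itself.\<close>

lemma stone_cech_bump:
  fixes z :: "'z::topological_space"
  assumes "compact Q" "sc_embed z \<notin> Q"
  obtains k :: "(('z \<Rightarrow>\<^sub>C real) \<Rightarrow> real) \<Rightarrow> real" where "continuous_on UNIV k"
    "\<And>q. 0 \<le> k q \<and> k q \<le> 1" "\<And>q. q \<in> Q \<Longrightarrow> k q = 0" "k (sc_embed z) = 1"
proof (cases "Q = {}")
  case True
  then show thesis
    using that[of "\<lambda>_. 1"] by simp
next
  case False
  have op: "open {q :: ('z \<Rightarrow>\<^sub>C real) \<Rightarrow> real. q f \<noteq> apply_bcontfun f z}" for f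
    by (intro open_Collect_neq continuous_on_coordinate continuous_on_const)
  have "Q \<subseteq> (\<Union>f\<in>UNIV. {q. q f \<noteq> apply_bcontfun f z})"
  proof
    fix q assume "q \<in> Q"
    then have "q \<noteq> sc_embed z"
      using assms(2) by blast
    then show "q \<in> (\<Union>f\<in>UNIV. {q. q f \<noteq> apply_bcontfun f z})"
      by (auto simp: sc_embed_def fun_eq_iff)
  qed
  then obtain \<Phi> where \<Phi>: "finite \<Phi>" "Q \<subseteq> (\<Union>f\<in>\<Phi>. {q. q f \<noteq> apply_bcontfun f z})"
    by (rule compactE_image[OF assms(1) op])
  define s where "s q = (\<Sum>f\<in>\<Phi>. \<bar>q f - f z\<bar>)" for q :: "('z \<Rightarrow>\<^sub>C real) \<Rightarrow> real"
  have cs: "continuous_on A s" for A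
    unfolding s_def by (intro continuous_intros continuous_on_coordinate)
  obtain q0 where q0: "q0 \<in> Q" "\<And>q. q \<in> Q \<Longrightarrow> s q0 \<le> s q"
    using continuous_attains_inf[OF assms(1) False cs] by blast
  obtain f where "f \<in> \<Phi>" "q0 f \<noteq> f z"
    using \<Phi>(2) q0(1) by blast
  then have c: "s q0 > 0"
    unfolding s_def using \<Phi>(1) by (intro sum_pos2[of _ f]) auto
  show thesis
  proof
    show "continuous_on UNIV (\<lambda>q. max 0 (1 - s q / s q0))"
      using c by (intro continuous_intros cs) auto
    have "s q \<ge> 0" for q
      by (simp add: s_def sum_nonneg)
    then show "0 \<le> max 0 (1 - s q / s q0) \<and> max 0 (1 - s q / s q0) \<le> 1" for q
      using c by simp
    show "max 0 (1 - s q / s q0) = 0" if "q \<in> Q" for q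
      using q0(2)[OF that] c by simp
    show "max 0 (1 - s (sc_embed z) / s q0) = 1"
      by (simp add: s_def sc_embed_def)
  qed
qed

text \<open>By the Lindelof property the positivity sets of countably many bumps cover the space; a
  geometric sum of these bumps is continuous, vanishes on \<open>Q\<close> and is positive at every
  point of the space.\<close>

lemma remainder_compact_separation:
  fixes Q :: "(('z::second_countable_topology \<Rightarrow>\<^sub>C real) \<Rightarrow> real) set"
  assumes "Q \<in> remainder_compacts"
  obtains k :: "(('z \<Rightarrow>\<^sub>C real) \<Rightarrow> real) \<Rightarrow> real"
  where "continuous_on stone_cech k" "\<And>q. q \<in> Q \<Longrightarrow> k q = 0" "\<And>z. k (sc_embed z) > 0"
proof -
  have "\<exists>k. continuous_on UNIV k \<and> (\<forall>q. 0 \<le> k q \<and> k q \<le> (1::real)) \<and> (\<forall>q\<in>Q. k q = 0) \<and> k (sc_embed z) = 1" for z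
  proof -
    have "compact Q" "sc_embed z \<notin> Q"
      using assms by (auto simp: remainder_compacts_def)
    from stone_cech_bump[OF this] show ?thesis
      by metis
  qed
  then obtain b where b: "\<And>z. continuous_on UNIV (b z)" "\<And>z q. 0 \<le> b z q \<and> b z q \<le> (1::real)"
    "\<And>z q. q \<in> Q \<Longrightarrow> b z q = 0" "\<And>z. b z (sc_embed z) = 1"
    by metis
  define W where "W z = {x. 0 < b z (sc_embed x)}" for z
  have "open (W z)" for z
    unfolding W_def
    by (intro open_Collect_less continuous_on_const continuous_on_compose2[OF b(1) continuous_on_sc_embed]) simp
  then have "open S" if "S \<in> range W" for S
    using that by blast
  from Lindelof[OF this] obtain F where F: "F \<subseteq> range W" "countable F" "\<Union> F = \<Union> (range W)"
    by metis
  then obtain Z where Z: "countable Z" "F = W ` Z"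
    by (metis countable_subset_image)
  have cover: "\<Union> (W ` Z) = UNIV"
    using F(3) Z(2) b(4) by (auto simp: W_def)
  then have "Z \<noteq> {}"
    by auto
  define \<phi> where "\<phi> n = b (from_nat_into Z n)" for n
  have \<phi>: "continuous_on stone_cech (\<phi> n)" "0 \<le> \<phi> n q \<and> \<phi> n q \<le> 1" for n q
    unfolding \<phi>_def using b continuous_on_subset by blast+
  show thesis
  proof
    show "continuous_on stone_cech (\<lambda>q. \<Sum>n. (1 / 2) ^ n * \<phi> n q)"
      using \<phi> by (rule geometric_series_of_unit_functions)
    show "(\<Sum>n. (1 / 2) ^ n * \<phi> n q) = 0" if "q \<in> Q" for q
      by (simp add: \<phi>_def b(3)[OF that])
    show "(\<Sum>n. (1 / 2) ^ n * \<phi> n (sc_embed x)) > 0" for x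
    proof -
      obtain z where "z \<in> Z" "x \<in> W z"
        using cover by blast
      then obtain n where "\<phi> n (sc_embed x) > 0"
        using from_nat_into_surj[OF Z(1)] unfolding \<phi>_def W_def by (metis mem_Collect_eq)
      then have "(1 / 2) ^ n * \<phi> n (sc_embed x) > 0"
        by simp
      then show ?thesis
        using geometric_series_of_unit_functions(2)[where \<phi> = \<phi> and n = n and x = "sc_embed x", OF \<phi>] by linarith
    qed
  qed
qed

section \<open>Cutoffs along the level sets of a positive function\<close>

definition ramp :: "real \<Rightarrow> real \<Rightarrow> real \<Rightarrow> real" where
  "ramp a b t = max 0 (min 1 ((t - a) / (b - a)))"

lemma ramp_unit: "0 \<le> ramp a b t" "ramp a b t \<le> 1"
  by (simp_all add: ramp_def)

lemma ramp_eq_0: "a < b \<Longrightarrow> t \<le> a \<Longrightarrow> ramp a b t = 0"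
  using divide_nonpos_pos[of "t - a" "b - a"] by (simp add: ramp_def)

lemma ramp_eq_1: "a < b \<Longrightarrow> b \<le> t \<Longrightarrow> ramp a b t = 1"
  by (simp add: ramp_def max_def min_def)

lemma continuous_on_ramp:
  assumes "continuous_on S f" "a < b"
  shows "continuous_on S (\<lambda>x. ramp a b (f x))"
  unfolding ramp_def using assms by (intro continuous_intros) auto

text \<open>\<open>Bcontfun\<close> is meaningful only for a bounded continuous product, which the
  assumptions of \<open>cutoff_apply\<close> guarantee.\<close>

definition cutoff :: "('z \<Rightarrow> real) \<Rightarrow> ('z::topological_space \<Rightarrow>\<^sub>C real) \<Rightarrow> 'z \<Rightarrow>\<^sub>C real" where
  "cutoff \<phi> f = Bcontfun (\<lambda>z. \<phi> z * f z)"

lemma cutoff_apply: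
  assumes "continuous_on UNIV \<phi>" "\<And>z. \<bar>\<phi> z\<bar> \<le> 1"
  shows "cutoff \<phi> f z = \<phi> z * f z"
proof -
  have "\<bar>\<phi> z\<bar> * \<bar>f z\<bar> \<le> norm f" for z
    using mult_mono[OF assms(2) norm_bounded[of f z]] by simp
  then have "(\<lambda>z. \<phi> z * f z) \<in> bcontfun"
    by (intro bcontfun_normI[where b = "norm f"] continuous_intros assms) (auto simp: abs_mult)
  then show ?thesis
    by (simp add: cutoff_def Bcontfun_inverse)
qed

text \<open>Intended for \<open>w x = k (sc_embed x)\<close> with \<open>k\<close> vanishing on
  \<open>Q\<close>: the levels \<open>\<epsilon> n\<close> then measure the approach to
  \<open>Q\<close>. Halving makes them strictly decreasing with limit zero.\<close>

locale null_scale =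
  fixes w :: "'x::metric_space \<Rightarrow> real" and \<epsilon> :: "nat \<Rightarrow> real"
  assumes w_cont: "continuous_on UNIV w"
    and w_pos: "\<And>x. w x > 0"
    and \<epsilon>_pos: "\<And>n. \<epsilon> n > 0"
    and \<epsilon>_half: "\<And>n. \<epsilon> (Suc n) \<le> \<epsilon> n / 2"
begin

lemma \<epsilon>_less: "\<epsilon> (Suc n) < \<epsilon> n"
  using \<epsilon>_half[of n] \<epsilon>_pos[of n] by simp

lemma \<epsilon>_mono: "m \<le> n \<Longrightarrow> \<epsilon> n \<le> \<epsilon> m"
  by (rule lift_Suc_antimono_le[of \<epsilon>]) (rule less_imp_le[OF \<epsilon>_less])

text \<open>Supplies the local condition of \<open>strict_null\<close>: near \<open>x\<close> the
  function \<open>w\<close> exceeds \<open>w x / 2\<close>, which lies above all late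
  levels.\<close>

lemma locally_above:
  obtains W N where "open W" "x \<in> W" "\<And>n z. n \<ge> N \<Longrightarrow> z \<in> W \<Longrightarrow> \<epsilon> n \<le> w z"
proof -
  have pow: "\<epsilon> n \<le> \<epsilon> 0 * (1 / 2) ^ n" for n
  proof (induction n)
    case (Suc n)
    then show ?case
      using \<epsilon>_half[of n] by simp
  qed simp
  obtain N where N: "(1 / 2) ^ N < w x / 2 / \<epsilon> 0"
    using real_arch_pow_inv[of "w x / 2 / \<epsilon> 0" "1 / 2"] w_pos[of x] \<epsilon>_pos[of 0] by auto
  show thesis
  proof
    show "open {z. w x / 2 < w z}"
      by (intro open_Collect_less continuous_on_const w_cont)
    show "x \<in> {z. w x / 2 < w z}"
      using w_pos[of x] by simp
    fix n z assume "n \<ge> N" "z \<in> {z. w x / 2 < w z}"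
    moreover have "\<epsilon> N \<le> w x / 2"
      using pow[of N] mult_strict_left_mono[OF N \<epsilon>_pos[of 0]] \<epsilon>_pos[of 0] by simp
    ultimately show "\<epsilon> n \<le> w z"
      using \<epsilon>_mono[of N n] by simp
  qed
qed

definition \<tau> :: "nat \<Rightarrow> 'x \<Rightarrow> real" where
  "\<tau> n x = ramp (\<epsilon> (Suc n)) (\<epsilon> n) (w x)"

lemma \<tau>_unit: "0 \<le> \<tau> n x" "\<tau> n x \<le> 1"
  by (simp_all add: \<tau>_def ramp_unit)

lemma \<tau>_cont: "continuous_on UNIV (\<tau> n)"
  using continuous_on_ramp[OF w_cont \<epsilon>_less, of n] unfolding \<tau>_def[abs_def] .

lemma \<tau>_eq_1: "\<epsilon> n \<le> w x \<Longrightarrow> \<tau> n x = 1"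
  by (simp add: \<tau>_def ramp_eq_1 \<epsilon>_less)

lemma \<tau>_eq_0: "w x \<le> \<epsilon> (Suc n) \<Longrightarrow> \<tau> n x = 0"
  by (simp add: \<tau>_def ramp_eq_0 \<epsilon>_less)

text \<open>The level \<open>\<epsilon> (Suc n)\<close> divides the cases: from it upwards the right
  side is 1, up to it the left side is 0.\<close>

lemma \<tau>_mono: "\<tau> n x \<le> \<tau> (Suc n) x"
  using \<tau>_eq_1[of "Suc n" x] \<tau>_eq_0[of x n] \<tau>_unit[of n x] \<tau>_unit[of "Suc n" x] by linarith

lemma cutoff_\<tau>:
  fixes f :: "'x \<Rightarrow>\<^sub>C real"
  shows "cutoff (\<tau> n) f x = \<tau> n x * f x"
  using \<tau>_unit by (intro cutoff_apply \<tau>_cont) (simp add: abs_le_iff)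

lemma norm_cutoff_\<tau>: "norm (cutoff (\<tau> n) f) \<le> norm f"
proof (rule norm_bound)
  fix x
  show "norm (cutoff (\<tau> n) f x) \<le> norm f"
    using mult_mono[of "\<tau> n x" 1 "\<bar>f x\<bar>" "norm f"] \<tau>_unit[of n x] norm_bounded[of f x]
    by (simp add: cutoff_\<tau> abs_mult)
qed

end

section \<open>Images of functions concentrated at small values of \<open>w\<close>\<close>

context closed_strict_map
begin

text \<open>The remainder is \<open>(1 - \<tau> n) * f\<close>. As \<open>\<tau> n\<close> increases
  with \<open>n\<close>, its variation at a point telescopes to at most \<open>norm f\<close>, and
  locally it is eventually zero; so \<open>strict_null\<close> applies.\<close>

lemma remainder_strict_null:
  assumes "null_scale w \<epsilon>"
  shows "limitin strict_topology (\<lambda>n. T (f - cutoff (null_scale.\<tau> w \<epsilon> n) f)) 0 sequentially"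
proof -
  interpret null_scale w \<epsilon> by fact
  show ?thesis
  proof (rule strict_null)
    fix N x
    have "\<bar>(f - cutoff (\<tau> n) f) x - (f - cutoff (\<tau> (Suc n)) f) x\<bar> = (\<tau> (Suc n) x - \<tau> n x) * \<bar>f x\<bar>" for n
      using \<tau>_mono[of n x] by (simp add: cutoff_\<tau> abs_mult flip: left_diff_distrib)
    then have "(\<Sum>n<N. \<bar>(f - cutoff (\<tau> n) f) x - (f - cutoff (\<tau> (Suc n)) f) x\<bar>) = (\<Sum>n<N. \<tau> (Suc n) x - \<tau> n x) * \<bar>f x\<bar>"
      by (simp only: sum_distrib_right)
    also have "\<dots> = (\<tau> N x - \<tau> 0 x) * \<bar>f x\<bar>"
      using sum_lessThan_telescope[of "\<lambda>n. \<tau> n x" N] by simp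
    also have "\<dots> \<le> norm f"
      using mult_mono[of "\<tau> N x - \<tau> 0 x" 1 "\<bar>f x\<bar>" "norm f"] \<tau>_unit[of N x] \<tau>_unit[of 0 x] norm_bounded[of f x]
      by simp
    finally show "(\<Sum>n<N. \<bar>(f - cutoff (\<tau> n) f) x - (f - cutoff (\<tau> (Suc n)) f) x\<bar>) \<le> norm f" .
  next
    fix x
    obtain W N where W: "open W" "x \<in> W" "\<And>n z. n \<ge> N \<Longrightarrow> z \<in> W \<Longrightarrow> \<epsilon> n \<le> w z"
      using locally_above[of x] by blast
    then have "\<forall>n\<ge>N. \<forall>z\<in>W. (f - cutoff (\<tau> n) f) z = 0"
      by (simp add: cutoff_\<tau> \<tau>_eq_1)
    then show "\<exists>W N. open W \<and> x \<in> W \<and> (\<forall>n\<ge>N. \<forall>z\<in>W. (f - cutoff (\<tau> n) f) z = 0)"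
      using W by blast
  qed
qed

text \<open>Otherwise there are counterexamples living at ever smaller values of \<open>w\<close>.
  Cutting each off at a still lower level gives a norm bounded sequence with disjoint supports, to
  which \<open>strict_null\<close> applies, against the choice of the images.\<close>

lemma uniformly_small_near_zero_set:
  fixes w :: "'x \<Rightarrow> real"
  assumes w: "continuous_on UNIV w" "\<And>x. w x > 0"
    and V: "openin strict_topology V" "convex V" "0 \<in> V"
  shows "\<exists>e>0. \<forall>f. norm f \<le> r \<longrightarrow> (\<forall>x. e \<le> w x \<longrightarrow> apply_bcontfun f x = 0) \<longrightarrow> T f \<in> V"
proof (rule ccontr)
  assume "\<not> ?thesis"
  then have contra: "\<exists>f. norm f \<le> r \<and> (\<forall>x. e \<le> w x \<longrightarrow> apply_bcontfun f x = 0) \<and> T f \<notin> V"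
    if "e > 0" for e
    using that by blast
  \<comment> \<open>Half of \<open>V\<close>: if \<open>T f\<close> is outside \<open>V\<close> and
    the remainder has its image in \<open>V'\<close>, then by convexity the image of the cutoff is
    outside \<open>V'\<close>.\<close>
  define V' where "V' = (\<lambda>y. 2 *\<^sub>R y) -` V"
  have V': "openin strict_topology V'" "0 \<in> V'"
    unfolding V'_def using openin_locally_convex_scaling[OF locally_convex_strict V(1)] V(3) by auto
  have step: "\<exists>g e'. e > 0 \<longrightarrow> 0 < e' \<and> e' \<le> e / 2 \<and> norm g \<le> r \<and>
      (\<forall>x. apply_bcontfun g x \<noteq> 0 \<longrightarrow> e' \<le> w x \<and> w x < e) \<and> T g \<notin> V'" for e
  proof (cases "e > 0")
    case True
    then obtain f where f: "norm f \<le> r" "\<And>x. e \<le> w x \<Longrightarrow> apply_bcontfun f x = 0" "T f \<notin> V"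
      using contra by blast
    \<comment> \<open>A dyadic scale to cut off the single function \<open>f\<close>; the new level
      \<open>e'\<close> is where \<open>\<tau> n\<close> has vanished, lowered to
      \<open>e / 2\<close> if necessary.\<close>
    interpret null_scale w "\<lambda>n. (1 / 2) ^ n"
      by standard (simp_all add: w)
    have "\<forall>\<^sub>F n in sequentially. T (f - cutoff (\<tau> n) f) \<in> V'"
      using remainder_strict_null[OF null_scale_axioms, of f] V' unfolding limitin_def by blast
    then obtain n where n: "T (f - cutoff (\<tau> n) f) \<in> V'"
      using eventually_happens'[OF sequentially_bot] by blast
    have "T (cutoff (\<tau> n) f) \<notin> V'"
    proof
      assume "T (cutoff (\<tau> n) f) \<in> V'"
      then have "(1 / 2) *\<^sub>R (2 *\<^sub>R T (cutoff (\<tau> n) f)) + (1 / 2) *\<^sub>R (2 *\<^sub>R T (f - cutoff (\<tau> n) f)) \<in> V"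
        using n unfolding V'_def by (intro convexD[OF V(2)]) auto
      then show False
        using f(3) by (simp add: linear_diff[OF linear])
    qed
    moreover have "min ((1 / 2) ^ Suc n) (e / 2) \<le> w x \<and> w x < e" if "cutoff (\<tau> n) f x \<noteq> 0" for x
      using that f(2)[of x] \<tau>_eq_0[of x n] by (force simp: cutoff_\<tau>)
    ultimately show ?thesis
      using True f(1) norm_cutoff_\<tau>[of n f]
      by (intro exI[of _ "cutoff (\<tau> n) f"] exI[of _ "min ((1 / 2) ^ Suc n) (e / 2)"]) simp
  qed simp
  obtain G E where GE: "\<And>e. e > 0 \<Longrightarrow> 0 < E e" "\<And>e. e > 0 \<Longrightarrow> E e \<le> e / 2" "\<And>e. e > 0 \<Longrightarrow> norm (G e) \<le> r"
    "\<And>e x. e > 0 \<Longrightarrow> apply_bcontfun (G e) x \<noteq> 0 \<Longrightarrow> E e \<le> w x \<and> w x < e" "\<And>e. e > 0 \<Longrightarrow> T (G e) \<notin> V'"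
    using step by metis
  \<comment> \<open>The next level is the lower end of the current band, which makes the supports
    disjoint.\<close>
  define \<epsilon> where "\<epsilon> = rec_nat 1 (\<lambda>_. E)"
  have \<epsilon>: "\<epsilon> 0 = 1" "\<epsilon> (Suc n) = E (\<epsilon> n)" for n
    by (simp_all add: \<epsilon>_def)
  have \<epsilon>_pos: "\<epsilon> n > 0" for n
    by (induction n) (simp_all add: \<epsilon> GE(1))
  interpret null_scale w \<epsilon>
  proof
    show "\<epsilon> (Suc n) \<le> \<epsilon> n / 2" for n
      unfolding \<epsilon> by (rule GE(2)[OF \<epsilon>_pos])
  qed (rule w \<epsilon>_pos)+
  define g where "g n = G (\<epsilon> n)" for n
  have g: "norm (g n) \<le> r" "g n x \<noteq> 0 \<Longrightarrow> \<epsilon> (Suc n) \<le> w x \<and> w x < \<epsilon> n" "T (g n) \<notin> V'" for n x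
    unfolding g_def \<epsilon> using GE \<epsilon>_pos by blast+
  have "r \<ge> 0"
    using g(1)[of 0] norm_ge_zero[of "g 0"] by linarith
  have disjoint_supports: "m = n" if "g m x \<noteq> 0" "g n x \<noteq> 0" for m n x
  proof (rule ccontr)
    assume "m \<noteq> n"
    then consider "Suc m \<le> n" | "Suc n \<le> m"
      by linarith
    then show False
      using g(2)[OF that(1)] g(2)[OF that(2)] \<epsilon>_mono[of "Suc m" n] \<epsilon>_mono[of "Suc n" m] by cases auto
  qed
  have sum_le: "(\<Sum>n\<in>A. \<bar>g n x\<bar>) \<le> r" if "finite A" for A x
  proof (cases "\<exists>m. g m x \<noteq> 0")
    case True
    then obtain m where m: "g m x \<noteq> 0"
      by blast
    have "(\<Sum>n\<in>A. \<bar>g n x\<bar>) \<le> (\<Sum>n\<in>insert m A. \<bar>g n x\<bar>)"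
      using that by (intro sum_mono2) auto
    also have "\<dots> = (\<Sum>n\<in>{m}. \<bar>g n x\<bar>)"
      using that disjoint_supports[OF m] by (intro sum.mono_neutral_right) auto
    also have "\<dots> \<le> r"
      using norm_bounded[of "g m" x] g(1)[of m] by simp
    finally show ?thesis .
  qed (use \<open>r \<ge> 0\<close> in simp)
  have "limitin strict_topology (\<lambda>n. T (g n)) 0 sequentially"
  proof (rule strict_null)
    fix N x
    have "(\<Sum>n<N. \<bar>g n x - g (Suc n) x\<bar>) \<le> (\<Sum>n<N. \<bar>g n x\<bar>) + (\<Sum>n<N. \<bar>g (Suc n) x\<bar>)"
      unfolding sum.distrib[symmetric] by (intro sum_mono) simp
    also have "(\<Sum>n<N. \<bar>g (Suc n) x\<bar>) = (\<Sum>n\<in>Suc ` {..<N}. \<bar>g n x\<bar>)"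
      by (simp add: sum.reindex)
    finally show "(\<Sum>n<N. \<bar>g n x - g (Suc n) x\<bar>) \<le> r + r"
      using sum_le[of "{..<N}" x] sum_le[of "Suc ` {..<N}" x] by simp
  next
    fix x
    obtain W N where W: "open W" "x \<in> W" "\<And>n z. n \<ge> N \<Longrightarrow> z \<in> W \<Longrightarrow> \<epsilon> n \<le> w z"
      using locally_above[of x] by blast
    then have "\<forall>n\<ge>N. \<forall>z\<in>W. g n z = 0"
      using g(2) by (meson not_le)
    then show "\<exists>W N. open W \<and> x \<in> W \<and> (\<forall>n\<ge>N. \<forall>z\<in>W. g n z = 0)"
      using W by blast
  qed
  then have "\<forall>\<^sub>F n in sequentially. T (g n) \<in> V'"
    using V' unfolding limitin_def by blast
  then show False
    using g(3) eventually_happens'[OF sequentially_bot] by blast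
qed

end

section \<open>Continuity of strictly closed linear maps\<close>

text \<open>Coefficients of elements of \<open>V\<close> add up, so that the pieces of
  \<open>T f\<close> can be collected one at a time.\<close>

lemma convex_cone_combination:
  fixes V :: "'v::real_vector set"
  assumes V: "convex V" and uv: "u \<in> V" "v \<in> V" and ab: "0 < a" "0 < b"
  obtains y where "y \<in> V" "a *\<^sub>R u + b *\<^sub>R v = (a + b) *\<^sub>R y"
proof
  show "(a / (a + b)) *\<^sub>R u + (b / (a + b)) *\<^sub>R v \<in> V"
    using ab by (intro convexD[OF V uv]) (auto simp: add_divide_distrib[symmetric])
  show "a *\<^sub>R u + b *\<^sub>R v = (a + b) *\<^sub>R ((a / (a + b)) *\<^sub>R u + (b / (a + b)) *\<^sub>R v)"
    using ab by (simp add: scaleR_right_distrib)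
qed

context closed_strict_map
begin

text \<open>\<open>T f\<close> is split into the image of \<open>cutoff (\<tau> 0) f\<close>, the
  images of successive differences of cutoffs, and a remainder. They are controlled by the norm
  bound of \<open>T\<close>, by \<open>uniformly_small_near_zero_set\<close> and by
  \<open>remainder_strict_null\<close> respectively, and lie in multiples of \<open>V\<close> whose
  factors sum to at most 1.\<close>

lemma preimage_contains_strict_ball:
  fixes k :: "(('x \<Rightarrow>\<^sub>C real) \<Rightarrow> real) \<Rightarrow> real"
  assumes k: "continuous_on stone_cech k" "\<And>z. k (sc_embed z) > 0"
    and V: "openin strict_topology V" "convex V" "0 \<in> V"
  shows "\<exists>h e. continuous_on stone_cech h \<and> (\<forall>q. k q = 0 \<longrightarrow> h q = 0) \<and> e > 0 \<and>
    (\<forall>f. strict_seminorm h f < e \<longrightarrow> T f \<in> V)"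
proof -
  define w where "w x = k (sc_embed x)" for x
  have w: "continuous_on UNIV w" "\<And>x. w x > 0"
    unfolding w_def using k(2) sc_embed_in_stone_cech
    by (auto intro!: continuous_on_compose2[OF k(1) continuous_on_sc_embed])
  \<comment> \<open>The \<open>n\<close>-th difference gets the summable share
    \<open>1 / 2 ^ (n + 2)\<close> of \<open>V\<close>; its norm will be at most
    \<open>2 ^ (n + 2)\<close>.\<close>
  have "\<exists>e>0. \<forall>f. norm f \<le> 2 ^ (n + 2) \<longrightarrow> (\<forall>x. e \<le> w x \<longrightarrow> apply_bcontfun f x = 0) \<longrightarrow>
      (2 ^ (n + 2)) *\<^sub>R T f \<in> V" for n :: nat
  proof -
    have "openin strict_topology ((\<lambda>y. (2 ^ (n + 2)) *\<^sub>R y) -` V)"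
      by (rule openin_locally_convex_scaling[OF locally_convex_strict V(1)])
    moreover have "convex ((\<lambda>y. (2 ^ (n + 2)) *\<^sub>R y) -` V)"
      using V(2) by (rule convex_linear_vimage[rotated]) (rule linear_scaleR)
    moreover have "0 \<in> (\<lambda>y. (2 ^ (n + 2)) *\<^sub>R y) -` V"
      using V(3) by simp
    ultimately show ?thesis
      using uniformly_small_near_zero_set[OF w, of "(\<lambda>y. (2 ^ (n + 2)) *\<^sub>R y) -` V" "2 ^ (n + 2)"]
      unfolding vimage_eq by blast
  qed
  then obtain e where e: "\<And>n. e n > 0" "\<And>n f. norm f \<le> 2 ^ (n + 2) \<Longrightarrow>
      (\<And>x. e n \<le> w x \<Longrightarrow> apply_bcontfun f x = 0) \<Longrightarrow> (2 ^ (n + 2)) *\<^sub>R T f \<in> V"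
    by metis
  \<comment> \<open>The minimum keeps the halving condition and confines the \<open>n\<close>-th
    difference to \<open>w x < e n\<close>.\<close>
  define \<epsilon> where "\<epsilon> = rec_nat (e 0) (\<lambda>n t. min (t / 2) (e (Suc n)))"
  have \<epsilon>: "\<epsilon> 0 = e 0" "\<epsilon> (Suc n) = min (\<epsilon> n / 2) (e (Suc n))" for n
    by (simp_all add: \<epsilon>_def)
  have \<epsilon>_pos: "\<epsilon> n > 0" for n
    by (induction n) (simp_all add: \<epsilon> e(1))
  have \<epsilon>_le: "\<epsilon> n \<le> e n" for n
    by (cases n) (simp_all add: \<epsilon>)
  interpret null_scale w \<epsilon>
    by standard (simp_all add: w \<epsilon>_pos \<epsilon>)
  obtain K where K: "K \<ge> 0" "\<And>f. norm (T f) \<le> K * norm f"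
    using norm_bound by blast
  obtain d where d: "d > 0" "\<And>y. norm y \<le> d \<Longrightarrow> y \<in> V"
    using strict_nhd_norm[OF V(1,3)] by blast
  \<comment> \<open>The bound 1 serves the norms of the differences, the other term brings four
    times the image of the first cutoff below \<open>d\<close> in norm. The summand 8 keeps the
    denominator positive.\<close>
  define \<eta> where "\<eta> = min 1 (d / (8 * K + 8))"
  have \<eta>: "0 < \<eta>" "\<eta> \<le> 1"
    using d K by (auto simp: \<eta>_def)
  have "8 * K * \<eta> \<le> (8 * K + 8) * (d / (8 * K + 8))"
    using \<eta> K by (intro mult_mono) (auto simp: \<eta>_def)
  then have K\<eta>: "4 * (K * (2 * \<eta>)) \<le> d"
    using K by simp
  let ?\<phi> = "\<lambda>n q. ramp (\<epsilon> (Suc n)) (\<epsilon> n) (k q)"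
  \<comment> \<open>Where \<open>w x \<ge> \<epsilon> n\<close> this weight is at least
    \<open>1 / 2 ^ n\<close>, so a small seminorm lets \<open>f\<close> grow at most like
    \<open>2 ^ n\<close> there. All ramps vanish where \<open>k\<close> does.\<close>
  define h where "h q = (\<Sum>n. (1 / 2) ^ n * ?\<phi> n q)" for q
  have \<phi>: "continuous_on stone_cech (?\<phi> n)" "0 \<le> ?\<phi> n q \<and> ?\<phi> n q \<le> 1" for n q
    by (auto intro: continuous_on_ramp[OF k(1) \<epsilon>_less] simp: ramp_unit)
  have h_cont: "continuous_on stone_cech h"
    unfolding h_def[abs_def] by (rule geometric_series_of_unit_functions(1)[OF \<phi>])
  have h_ge: "(1 / 2) ^ n * \<tau> n x \<le> h (sc_embed x)" for n x
    unfolding h_def \<tau>_def w_def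
    by (rule geometric_series_of_unit_functions(2)[where \<phi> = ?\<phi>, OF \<phi>])
  have h_0: "h q = 0" if "k q = 0" for q
    unfolding h_def by (simp add: that ramp_eq_0 \<epsilon>_less less_imp_le[OF \<epsilon>_pos])
  have "T f \<in> V" if f: "strict_seminorm h f < \<eta>" for f
  proof -
    have f_le: "\<bar>f x\<bar> \<le> 2 ^ n * \<eta>" if "\<epsilon> n \<le> w x" for n x
    proof -
      have "(1 / 2) ^ n * \<bar>f x\<bar> \<le> \<bar>h (sc_embed x)\<bar> * \<bar>f x\<bar>"
        using h_ge[of n x] \<tau>_eq_1[OF that] by (intro mult_right_mono) auto
      also have "\<dots> < \<eta>"
        using strict_seminorm_upper[OF h_cont, of x f] f by (simp add: abs_mult)
      finally show ?thesis
        by (simp add: field_simps)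
    qed
    \<comment> \<open>The exponent is \<open>Suc n\<close> because \<open>\<tau> n\<close> is
      nonzero down to the level \<open>\<epsilon> (Suc n)\<close>.\<close>
    have cutoff_le: "\<bar>\<tau> n x * f x\<bar> \<le> 2 ^ Suc n * \<eta>" for n x
    proof (cases "w x \<le> \<epsilon> (Suc n)")
      case True
      then show ?thesis
        using \<eta> by (simp add: \<tau>_eq_0)
    next
      case False
      then have "1 * \<bar>f x\<bar> \<le> 2 ^ Suc n * \<eta>"
        using f_le[of "Suc n" x] by simp
      moreover have "\<tau> n x * \<bar>f x\<bar> \<le> 1 * \<bar>f x\<bar>"
        using \<tau>_unit by (intro mult_right_mono) auto
      ultimately show ?thesis
        using \<tau>_unit[of n x] by (simp only: abs_mult abs_of_nonneg)
    qed
    have piece: "(2 ^ (n + 2)) *\<^sub>R T (cutoff (\<tau> (Suc n)) f - cutoff (\<tau> n) f) \<in> V" for n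
    proof (rule e(2))
      show "(cutoff (\<tau> (Suc n)) f - cutoff (\<tau> n) f) x = 0" if "e n \<le> w x" for x
        using that \<epsilon>_le[of n] \<epsilon>_mono[of n "Suc n"] by (simp add: cutoff_\<tau> \<tau>_eq_1)
      show "norm (cutoff (\<tau> (Suc n)) f - cutoff (\<tau> n) f) \<le> 2 ^ (n + 2)"
      proof (rule Bounded_Continuous_Function.norm_bound)
        fix x
        have "\<bar>\<tau> (Suc n) x - \<tau> n x\<bar> \<le> \<tau> (Suc n) x"
          using \<tau>_mono[of n x] \<tau>_unit[of n x] by simp
        then have "\<bar>\<tau> (Suc n) x - \<tau> n x\<bar> * \<bar>f x\<bar> \<le> \<tau> (Suc n) x * \<bar>f x\<bar>"
          by (intro mult_right_mono) auto
        also have "\<dots> = \<bar>\<tau> (Suc n) x * f x\<bar>"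
          using \<tau>_unit[of "Suc n" x] by (simp add: abs_mult)
        also have "\<dots> \<le> 2 ^ Suc (Suc n) * \<eta>"
          by (rule cutoff_le)
        also have "\<dots> \<le> 2 ^ Suc (Suc n) * 1"
          using \<eta>(2) by (intro mult_left_mono) auto
        finally show "norm ((cutoff (\<tau> (Suc n)) f - cutoff (\<tau> n) f) x) \<le> 2 ^ (n + 2)"
          by (simp add: cutoff_\<tau> abs_mult flip: left_diff_distrib)
      qed
    qed
    \<comment> \<open>The coefficient is \<open>1 / 4\<close> for the first cutoff plus
      \<open>1 / 2 ^ (j + 2)\<close> for each \<open>j < n\<close>.\<close>
    have partial_sum: "\<exists>v\<in>V. T (cutoff (\<tau> n) f) = (3 / 4 - (1 / 2) ^ Suc n) *\<^sub>R v" for n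
    proof (induction n)
      case 0
      have "norm (cutoff (\<tau> 0) f) \<le> 2 * \<eta>"
        using cutoff_le[of 0] by (intro Bounded_Continuous_Function.norm_bound) (simp add: cutoff_\<tau>)
      then have "norm (4 *\<^sub>R T (cutoff (\<tau> 0) f)) \<le> d"
        using K(2)[of "cutoff (\<tau> 0) f"] mult_left_mono[of "norm (cutoff (\<tau> 0) f)" "2 * \<eta>" K] K(1) K\<eta>
        by simp
      then have "4 *\<^sub>R T (cutoff (\<tau> 0) f) \<in> V"
        by (rule d(2))
      then show ?case
        by (intro bexI[of _ "4 *\<^sub>R T (cutoff (\<tau> 0) f)"]) simp_all
    next
      case (Suc n)
      then obtain v where v: "v \<in> V" "T (cutoff (\<tau> n) f) = (3 / 4 - (1 / 2) ^ Suc n) *\<^sub>R v"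
        by blast
      have "(1 / 2 :: real) ^ Suc n \<le> (1 / 2) ^ 1"
        by (rule power_decreasing) auto
      then have pos: "3 / 4 - (1 / 2 :: real) ^ Suc n > 0"
        by simp
      have "T (cutoff (\<tau> (Suc n)) f) = T (cutoff (\<tau> n) f) + T (cutoff (\<tau> (Suc n)) f - cutoff (\<tau> n) f)"
        by (simp add: linear_diff[OF linear])
      also have "T (cutoff (\<tau> (Suc n)) f - cutoff (\<tau> n) f)
          = (1 / 2) ^ (n + 2) *\<^sub>R ((2 ^ (n + 2)) *\<^sub>R T (cutoff (\<tau> (Suc n)) f - cutoff (\<tau> n) f))"
        by (simp only: scaleR_scaleR power_mult_distrib[symmetric]) simp
      finally have eq: "T (cutoff (\<tau> (Suc n)) f) = (3 / 4 - (1 / 2) ^ Suc n) *\<^sub>R v +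
          (1 / 2) ^ (n + 2) *\<^sub>R ((2 ^ (n + 2)) *\<^sub>R T (cutoff (\<tau> (Suc n)) f - cutoff (\<tau> n) f))"
        by (simp only: v(2))
      have "0 < (1 / 2 :: real) ^ (n + 2)"
        by simp
      then obtain y where y: "y \<in> V"
        "(3 / 4 - (1 / 2) ^ Suc n) *\<^sub>R v +
          (1 / 2) ^ (n + 2) *\<^sub>R ((2 ^ (n + 2)) *\<^sub>R T (cutoff (\<tau> (Suc n)) f - cutoff (\<tau> n) f))
          = (3 / 4 - (1 / 2) ^ Suc n + (1 / 2) ^ (n + 2)) *\<^sub>R y"
        by (rule convex_cone_combination[OF V(2) v(1) piece[of n] pos]) (rule that)
      have coefficient: "3 / 4 - (1 / 2 :: real) ^ Suc n + (1 / 2) ^ (n + 2) = 3 / 4 - (1 / 2) ^ Suc (Suc n)"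
        by simp
      show ?case
        using trans[OF eq y(2)] unfolding coefficient by (rule bexI[OF _ y(1)])
    qed
    have "openin strict_topology ((\<lambda>y. 4 *\<^sub>R y) -` V)" "0 \<in> (\<lambda>y. 4 *\<^sub>R y) -` V"
      using openin_locally_convex_scaling[OF locally_convex_strict V(1)] V(3) by auto
    then have "\<forall>\<^sub>F n in sequentially. T (f - cutoff (\<tau> n) f) \<in> (\<lambda>y. 4 *\<^sub>R y) -` V"
      using remainder_strict_null[OF null_scale_axioms, of f] unfolding limitin_def by blast
    from eventually_happens'[OF sequentially_bot this]
    obtain n where n: "4 *\<^sub>R T (f - cutoff (\<tau> n) f) \<in> V"
      by auto
    obtain v where v: "v \<in> V" "T (cutoff (\<tau> n) f) = (3 / 4 - (1 / 2) ^ Suc n) *\<^sub>R v"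
      using partial_sum by blast
    let ?a = "3 / 4 - (1 / 2 :: real) ^ Suc n"
    have "(1 / 2 :: real) ^ Suc n \<le> (1 / 2) ^ 1"
      by (rule power_decreasing) auto
    then have a: "?a > 0" "?a + 1 / 4 \<le> 1"
      by simp_all
    have "T f = ?a *\<^sub>R v + (1 / 4) *\<^sub>R (4 *\<^sub>R T (f - cutoff (\<tau> n) f))"
      using v(2) by (simp add: linear_diff[OF linear])
    then obtain y where y: "y \<in> V" "T f = (?a + 1 / 4) *\<^sub>R y"
      using convex_cone_combination[OF V(2) v(1) n a(1), of "1 / 4"] by auto
    \<comment> \<open>The coefficient that is missing to 1 is given to
      \<open>0 \<in> V\<close>.\<close>
    have "(1 - (?a + 1 / 4)) *\<^sub>R 0 + (?a + 1 / 4) *\<^sub>R y \<in> V"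
      using a by (intro convexD[OF V(2) V(3) y(1)]) auto
    then show ?thesis
      using y(2) by simp
  qed
  then show ?thesis
    using h_cont h_0 \<eta>(1) by blast
qed

end

text \<open>Linearity transports the vector operations and convex neighbourhoods back along
  \<open>T\<close>. This makes the pullback of the strict topology eligible as a candidate.\<close>

lemma locally_convex_pullback:
  fixes T :: "'u::real_vector \<Rightarrow> 'v::real_vector"
  assumes lin: "linear T" and lc: "locally_convex_topology \<tau>"
  shows "locally_convex_topology (pullback_topology UNIV T \<tau>)"
proof -
  let ?p = "pullback_topology UNIV T \<tau>"
  have sp: "topspace \<tau> = UNIV" "topspace ?p = UNIV"
    using lc by (simp_all add: locally_convex_topology_def topspace_pullback_topology)
  have T: "continuous_map ?p \<tau> T"
    using continuous_map_pullback[of \<tau> \<tau> id UNIV T] by simp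
  have into: "continuous_map S ?p g" if "continuous_map S \<tau> (T \<circ> g)" for S :: "'w topology" and g
    using that by (intro continuous_map_pullback') auto
  have "continuous_map (prod_topology ?p ?p) (prod_topology \<tau> \<tau>) (\<lambda>(x, y). (T x, T y))"
    by (subst continuous_map_prod_top) (simp add: T)
  moreover have "continuous_map (prod_topology \<tau> \<tau>) \<tau> (\<lambda>(x, y). x + y)"
    using lc by (simp add: locally_convex_topology_def)
  ultimately have "continuous_map (prod_topology ?p ?p) \<tau> ((\<lambda>(x, y). x + y) \<circ> (\<lambda>(x, y). (T x, T y)))"
    by (rule continuous_map_compose)
  then have add: "continuous_map (prod_topology ?p ?p) ?p (\<lambda>(x, y). x + y)"
    by (intro into) (simp add: o_def case_prod_unfold linear_add[OF lin])
  have "continuous_map (prod_topology euclideanreal ?p) (prod_topology euclideanreal \<tau>) (\<lambda>(c, x). (c, T x))"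
    by (subst continuous_map_prod_top) (simp add: T)
  moreover have "continuous_map (prod_topology euclideanreal \<tau>) \<tau> (\<lambda>(c, x). c *\<^sub>R x)"
    using lc by (simp add: locally_convex_topology_def)
  ultimately have "continuous_map (prod_topology euclideanreal ?p) \<tau> ((\<lambda>(c, x). c *\<^sub>R x) \<circ> (\<lambda>(c, x). (c, T x)))"
    by (rule continuous_map_compose)
  then have scale: "continuous_map (prod_topology euclideanreal ?p) ?p (\<lambda>(c, x). c *\<^sub>R x)"
    by (intro into) (simp add: o_def case_prod_unfold linear_scale[OF lin])
  have "\<exists>V. openin ?p V \<and> convex V \<and> 0 \<in> V \<and> V \<subseteq> U" if U: "openin ?p U" "0 \<in> U" for U
  proof -
    obtain U' where U': "openin \<tau> U'" "U = T -` U'"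
      using U(1) by (auto simp: openin_pullback_topology)
    then have "0 \<in> U'"
      using U(2) linear_0[OF lin] by simp
    then obtain V where V: "openin \<tau> V" "convex V" "0 \<in> V" "V \<subseteq> U'"
      using lc U'(1) unfolding locally_convex_topology_def by meson
    have "openin ?p (T -` V)"
      using V(1) by (auto simp: openin_pullback_topology)
    moreover have "convex (T -` V)"
      using lin V(2) by (rule convex_linear_vimage)
    ultimately show ?thesis
      using V(3,4) U'(2) linear_0[OF lin] by (intro exI[of _ "T -` V"]) auto
  qed
  then show ?thesis
    unfolding locally_convex_topology_def using sp(2) add scale by blast
qed

theorem corollary1p10:
  fixes T :: "('x::{metric_space, second_countable_topology} \<Rightarrow>\<^sub>C real) \<Rightarrow>
              ('y::{metric_space, second_countable_topology} \<Rightarrow>\<^sub>C real)"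
  assumes "linear T"
    and "closedin (prod_topology strict_topology strict_topology) (range (\<lambda>f. (f, T f)))"
  shows "continuous_map strict_topology strict_topology T"
proof -
  interpret closed_strict_map T
    using assms by (rule closed_strict_map.intro)
  \<comment> \<open>Openness of preimages in every \<open>beta_Q\<close> is enough: the pullback
    topology is then a candidate, hence coarser than the strict topology, which is the finest
    one.\<close>
  have "openin (beta_Q Q) (T -` U)"
    if Q: "Q \<in> remainder_compacts" and U: "openin strict_topology U" for Q U
  proof (rule openin_beta_Q_ballI)
    fix f assume "f \<in> T -` U"
    then have "openin strict_topology ((\<lambda>y. T f + y) -` U)" "0 \<in> (\<lambda>y. T f + y) -` U"
      using openin_locally_convex_translation[OF locally_convex_strict U] by auto
    then obtain V where V: "openin strict_topology V" "convex V" "0 \<in> V" "V \<subseteq> (\<lambda>y. T f + y) -` U"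
      by (rule strict_convex_nhd) (rule that)
    \<comment> \<open>Since \<open>k\<close> vanishes on \<open>Q\<close>, so does any weight that
      vanishes wherever \<open>k\<close> does.\<close>
    obtain k :: "(('x \<Rightarrow>\<^sub>C real) \<Rightarrow> real) \<Rightarrow> real"
      where k: "continuous_on stone_cech k" "\<And>q. q \<in> Q \<Longrightarrow> k q = 0" "\<And>z. k (sc_embed z) > 0"
      using that by (rule remainder_compact_separation[OF Q])
    obtain h e where h: "continuous_on stone_cech h" "\<forall>q. k q = 0 \<longrightarrow> h q = 0" "e > 0"
      "\<forall>f. strict_seminorm h f < e \<longrightarrow> T f \<in> V"
      using preimage_contains_strict_ball[OF k(1,3) V(1-3)] by blast
    have "g \<in> T -` U" if "strict_seminorm h (g - f) < e" for g
    proof -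
      have "T g - T f \<in> V"
        using h(4) that linear_diff[OF assms(1), of g f] by metis
      then show ?thesis
        using V(4) by auto
    qed
    then show "\<exists>h e. continuous_on stone_cech h \<and> (\<forall>q\<in>Q. h q = 0) \<and> e > 0 \<and>
        (\<forall>g. strict_seminorm h (g - f) < e \<longrightarrow> g \<in> T -` U)"
      using h(1-3) k(2) by blast
  qed
  then have "pullback_topology UNIV T strict_topology \<in> strict_candidates"
    using locally_convex_pullback[OF assms(1) locally_convex_strict]
    by (auto simp: strict_candidates_def coarser_topology_def openin_pullback_topology)
  then have coarser: "coarser_topology (pullback_topology UNIV T strict_topology) strict_topology"
    by (rule strict_topology_finest(2))
  have "openin strict_topology (T -` U)" if "openin strict_topology U" for U
    using coarser that unfolding coarser_topology_def openin_pullback_topology by auto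
  then show ?thesis
    by (simp add: continuous_map_alt topspace_strict)
qed

end
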